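(* For every $\alpha>0$ there exists $\varepsilon>0$ such that \[0<\liminf_{t\to\infty}\phi_\alpha(t)^{-\varepsilon}\,\mathbf{E}\left(p_t^\omega(0,0)^\varepsilon\right)\le\limsup_{t\to\infty}\phi_\alpha(t)^{-\varepsilon}\,\mathbf{E}\left(p_t^\omega(0,0)^\varepsilon\right)<\infty.\] Moreover, if $\alpha>\frac32$, then one may take $\varepsilon=1$.
   Context: One-dimensional symmetric Bouchaud trap model. Fix $\alpha>0$. Let $\tau=\{\tau_x\}_{x\in\mathbb{Z}}$ be i.i.d. random variables (the random environment, with law $\mathbf{P}$ and expectation $\mathbf{E}$; $\omega$ denotes a realisation of the environment) with $\mathbf{P}(\tau_x>u)=u^{-\alpha}$ for all $u\ge 1$. Given $\tau$, let $X=(X_t)_{t\ge0}$ be the continuous-time Markov chain on $\mathbb{Z}$ with generator $\mathcal{L}f(x)=\frac{1}{2\tau_x}\sum_{y\sim x}(f(y)-f(x))$ (sum over the two nearest neighbours of $x$). Write $P^\omega_x$ for the quenched law of $X$ started at $x$. The quenched heat kernel is $p_t^\omega(x,y)=P^\omega_x(X_t=y)/\tau_y$. Define $\phi_\alpha(t)=t^{-1/(1+\alpha)}$ if $\alpha\in(0,1)$, $\phi_\alpha(t)=t^{-1/2}(\log t)^{-1/2}$ if $\alpha=1$, and $\phi_\alpha(t)=t^{-1/2}$ if $\alpha>1$. *)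

theory Defs
  imports "HOL-Probability.Probability"
begin

text \<open>Generator of the symmetric Bouchaud trap model on the integers in environment tau:
  matrix entries L(x,y) = 1/(2 tau x) for y = x+1 or y = x-1, and -1/tau x for y = x.\<close>
definition bt_rate :: "(int \<Rightarrow> real) \<Rightarrow> int \<Rightarrow> int \<Rightarrow> real" where
  "bt_rate \<tau> x y =
     (if y = x + 1 \<or> y = x - 1 then 1 / (2 * \<tau> x) else if y = x then - 1 / \<tau> x else 0)"

text \<open>Matrix powers L^n(x,y) (the rows of L have finite support {x-1,x,x+1}).\<close>
fun bt_Lpow :: "(int \<Rightarrow> real) \<Rightarrow> nat \<Rightarrow> int \<Rightarrow> int \<Rightarrow> real" where
  "bt_Lpow \<tau> 0 x y = (if x = y then 1 else 0)"
| "bt_Lpow \<tau> (Suc n) x y = (\<Sum>z\<in>{x - 1, x, x + 1}. bt_rate \<tau> x z * bt_Lpow \<tau> n z y)"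

text \<open>Quenched transition probability P^omega_x(X_t = y) = (exp(tL))(x,y);
  the generator is bounded since tau \<ge> 1, so the semigroup is the exponential series.\<close>
definition bt_trans :: "(int \<Rightarrow> real) \<Rightarrow> real \<Rightarrow> int \<Rightarrow> int \<Rightarrow> real" where
  "bt_trans \<tau> t x y = (\<Sum>n. t ^ n / fact n * bt_Lpow \<tau> n x y)"

definition bt_heat_kernel :: "(int \<Rightarrow> real) \<Rightarrow> real \<Rightarrow> int \<Rightarrow> int \<Rightarrow> real" where
  "bt_heat_kernel \<tau> t x y = bt_trans \<tau> t x y / \<tau> y"

definition phi_alpha :: "real \<Rightarrow> real \<Rightarrow> real" where
  "phi_alpha \<alpha> t =
     (if \<alpha> < 1 then t powr (- 1 / (1 + \<alpha>))
      else if \<alpha> = 1 then t powr (- 1 / 2) * (ln t) powr (- 1 / 2)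
      else t powr (- 1 / 2))"

end

theory Submission
  imports Defs "HOL-Real_Asymp.Real_Asymp"
begin

text \<open>
  Write \<open>V r\<close> for the total depth of the traps in \<open>{-r..r}\<close>. Uniformisation expresses the heat
  kernel as a Poisson mixture of the kernel of the lazy chain \<open>P = I + L/2\<close>, and in discrete time
  all functions have finite support.

  Upper bound: \<open>f\<^sub>n = P\<^sup>n (\<delta>\<^sub>0 / \<tau> 0)\<close> has mass one, so it is at most \<open>1 / V r\<close> somewhere in the ball,
  and its increments are controlled by the Dirichlet form, which is at most \<open>4 f\<^sub>n(0) / n\<close> since
  \<open>f\<^sub>n(0)\<close> is convex in \<open>n\<close>. This gives \<open>p\<^sub>t(0,0) \<le> 2 / V r + 16 r / t\<close>.

  Lower bound: a superposition of tents, centred at the traps of \<open>{-m..m}\<close> and weighted by their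
  depths, is bent downwards at \<open>x\<close> only in proportion to \<open>\<tau> x\<close>; hence it decays at rate at most
  \<open>1 / (2 m V m)\<close> under the semigroup. With the Cauchy--Schwarz inequality this gives
  \<open>p\<^sub>t(0,0) \<ge> exp (- t / (2 m V m)) / (8 V (5 m))\<close>.

  Taking \<open>r = m\<close> of order \<open>t \<phi>(t)\<close>, it remains to see that \<open>V m\<close> is of order \<open>1 / \<phi>(t)\<close>, with a negative
  moment from above and with positive probability from below. For \<open>\<alpha> < 1\<close> the exponent is
  \<open>\<epsilon> = \<alpha>\<close>, because \<open>V m powr -\<alpha>\<close> is at most the minimum of independent uniform variables
  \<open>\<tau> x powr -\<alpha>\<close>; for \<open>\<alpha> \<ge> 1\<close> it is \<open>\<epsilon> = 1\<close>.
\<close>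

section \<open>Quenched heat kernel bounds\<close>

locale trap_landscape =
  fixes \<tau> :: "int \<Rightarrow> real"
  assumes trap_ge_1: "1 \<le> \<tau> x"
begin

text \<open>This is \<open>I + L/2\<close> for the generator \<open>L\<close>. As depths are at
  least 1, the chain holds with probability at least 1/2; besides positivity this gives a positive
  semidefinite operator in \<open>ip_lazy_step_nonneg\<close>.\<close>

definition lazy_step :: "(int \<Rightarrow> real) \<Rightarrow> int \<Rightarrow> real" where
  "lazy_step f x = f x + (f (x + 1) + f (x - 1) - 2 * f x) / (4 * \<tau> x)"

text \<open>Carrying the support radius explicitly keeps every sum finite; one step of the chain
  enlarges the radius by one.\<close>

definition vanishes_beyond :: "int \<Rightarrow> (int \<Rightarrow> real) \<Rightarrow> bool" where
  "vanishes_beyond N f \<longleftrightarrow> (\<forall>x. N < \<bar>x\<bar> \<longrightarrow> f x = 0)"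

text \<open>The depths form the reversible measure. The cut-off inner product is the full one as
  soon as one argument vanishes beyond \<open>N\<close>.\<close>

definition ip :: "int \<Rightarrow> (int \<Rightarrow> real) \<Rightarrow> (int \<Rightarrow> real) \<Rightarrow> real" where
  "ip N f g = (\<Sum>x=-N..N. \<tau> x * f x * g x)"

text \<open>Starting at \<open>-N-1\<close> includes the edge entering the interval from the left,
  so no nonzero increment of a function vanishing beyond \<open>N\<close> is missed.\<close>

definition energy :: "int \<Rightarrow> (int \<Rightarrow> real) \<Rightarrow> real" where
  "energy N f = (\<Sum>x=-N-1..N. (f (x + 1) - f x)\<^sup>2)"

definition volume :: "nat \<Rightarrow> real" where
  "volume r = (\<Sum>x=-int r..int r. \<tau> x)"

text \<open>The factor \<open>1 / \<tau> 0\<close> makes this the probability of going from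
  \<open>x\<close> to 0 in \<open>n\<close> lazy steps divided by the depth at 0. By reversibility
  it is also the density, with respect to the depths, of the chain started at 0.\<close>

definition lazy_kernel :: "nat \<Rightarrow> int \<Rightarrow> real" where
  "lazy_kernel n = (lazy_step ^^ n) (\<lambda>x. if x = 0 then 1 / \<tau> 0 else 0)"

lemma trap_pos: "0 < \<tau> x"
  using trap_ge_1[of x] by linarith

lemma trap_nz [simp]: "\<tau> x \<noteq> 0"
  using trap_pos[of x] by simp

lemma volume_ge: "2 * real r + 1 \<le> volume r"
proof -
  have "(\<Sum>x=-int r..int r. (1::real)) \<le> volume r"
    unfolding volume_def by (intro sum_mono trap_ge_1)
  then show ?thesis by simp
qed

lemma volume_pos: "0 < volume r"
  using volume_ge[of r] by linarith

lemma vanishes_beyond_mono: "vanishes_beyond M f \<Longrightarrow> M \<le> N \<Longrightarrow> vanishes_beyond N f"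
  by (auto simp: vanishes_beyond_def)

lemma vanishes_beyond_step: "vanishes_beyond N f \<Longrightarrow> vanishes_beyond (N + 1) (lazy_step f)"
  by (auto simp: vanishes_beyond_def lazy_step_def)

lemma vanishes_beyond_diff:
  "vanishes_beyond N f \<Longrightarrow> vanishes_beyond N g \<Longrightarrow> vanishes_beyond N (\<lambda>x. f x - g x)"
  by (auto simp: vanishes_beyond_def)

lemma lazy_step_mono: "(\<And>y. f y \<le> g y) \<Longrightarrow> lazy_step f x \<le> lazy_step g x"
proof -
  assume le: "\<And>y. f y \<le> g y"
  have *: "lazy_step h x = (1 - 1 / (2 * \<tau> x)) * h x + (h (x + 1) + h (x - 1)) / (4 * \<tau> x)" for h
    by (simp add: lazy_step_def field_simps)
  have "1 / (2 * \<tau> x) \<le> 1"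
    using trap_ge_1[of x] by simp
  then show ?thesis
    unfolding * using le trap_pos[of x]
    by (intro add_mono mult_left_mono divide_right_mono) auto
qed

text \<open>Summation by parts: the range is first enlarged where \<open>g\<close> vanishes, then
  shifted, then shrunk where \<open>f\<close> vanishes, so no boundary term appears.\<close>

lemma shift_sum:
  assumes "vanishes_beyond N f" "vanishes_beyond N g"
  shows "(\<Sum>x=-N..N. g x * f (x + 1)) = (\<Sum>x=-N..N. g (x - 1) * f x)"
proof -
  have "(\<Sum>x=-N..N. g x * f (x + 1)) = (\<Sum>x=-N-1..N. g x * f (x + 1))"
    using assms by (intro sum.mono_neutral_left) (auto simp: vanishes_beyond_def)
  also have "\<dots> = (\<Sum>x=-N..N+1. g (x - 1) * f x)"
    by (rule sum.reindex_bij_witness[where i = "\<lambda>x. x - 1" and j = "\<lambda>x. x + 1"]) auto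
  also have "\<dots> = (\<Sum>x=-N..N. g (x - 1) * f x)"
    using assms by (intro sum.mono_neutral_right) (auto simp: vanishes_beyond_def)
  finally show ?thesis .
qed

text \<open>The weight \<tau> cancels the denominator of the step, so the environment survives only
  in \<open>ip N f g\<close>; the rest is the form of simple random walk, visibly symmetric up to
  shifts.\<close>

lemma ip_lazy_step:
  "ip N f (lazy_step g) =
     ip N f g + ((\<Sum>x=-N..N. f x * g (x + 1)) + (\<Sum>x=-N..N. f x * g (x - 1))
                  - 2 * (\<Sum>x=-N..N. f x * g x)) / 4"
proof -
  have *: "\<tau> x * f x * lazy_step g x =
      \<tau> x * f x * g x + (f x * g (x + 1) + f x * g (x - 1) - 2 * (f x * g x)) / 4" for x
    by (simp add: lazy_step_def field_simps)
  show ?thesis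
    unfolding ip_def *
    by (simp add: sum.distrib sum_subtractf sum_divide_distrib[symmetric] sum_distrib_left[symmetric])
qed

lemma ip_commute: "ip N f g = ip N g f"
  by (simp add: ip_def mult_ac)

lemma ip_diff_left: "ip N (\<lambda>x. f x - g x) h = ip N f h - ip N g h"
  by (simp add: ip_def algebra_simps sum_subtractf)

lemma ip_diff_right: "ip N h (\<lambda>x. f x - g x) = ip N h f - ip N h g"
  by (simp add: ip_def algebra_simps sum_subtractf)

lemma ip_nonneg: "0 \<le> ip N f f"
  unfolding ip_def using trap_pos by (intro sum_nonneg) (simp add: less_imp_le mult.assoc)

lemma lazy_step_self_adjoint:
  assumes "vanishes_beyond N f" "vanishes_beyond N g"
  shows "ip N (lazy_step f) g = ip N f (lazy_step g)"
proof -
  have "ip N (lazy_step f) g = ip N g (lazy_step f)"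
    by (rule ip_commute)
  also have "\<dots> = ip N f (lazy_step g)"
    unfolding ip_lazy_step ip_commute[of N g f] shift_sum[OF assms] shift_sum[OF assms(2,1)]
    by (simp add: mult.commute add.commute)
  finally show ?thesis .
qed

lemma sum_squares_shift:
  assumes "vanishes_beyond N f"
  shows "(\<Sum>x=-N-1..N. (f (x + 1))\<^sup>2) = (\<Sum>x=-N..N. (f x)\<^sup>2)"
    and "(\<Sum>x=-N-1..N. (f x)\<^sup>2) = (\<Sum>x=-N..N. (f x)\<^sup>2)"
proof -
  have "(\<Sum>x=-N-1..N. (f (x + 1))\<^sup>2) = (\<Sum>x=-N..N+1. (f x)\<^sup>2)"
    by (rule sum.reindex_bij_witness[where i = "\<lambda>x. x - 1" and j = "\<lambda>x. x + 1"]) auto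
  also have "\<dots> = (\<Sum>x=-N..N. (f x)\<^sup>2)"
    using assms by (intro sum.mono_neutral_right) (auto simp: vanishes_beyond_def)
  finally show "(\<Sum>x=-N-1..N. (f (x + 1))\<^sup>2) = (\<Sum>x=-N..N. (f x)\<^sup>2)" .
  show "(\<Sum>x=-N-1..N. (f x)\<^sup>2) = (\<Sum>x=-N..N. (f x)\<^sup>2)"
    using assms by (intro sum.mono_neutral_right) (auto simp: vanishes_beyond_def)
qed

lemma dirichlet_form:
  assumes "vanishes_beyond N f"
  shows "ip N f f - ip N f (lazy_step f) = energy N f / 4"
proof -
  have cross: "(\<Sum>x=-N-1..N. f x * f (x + 1)) = (\<Sum>x=-N..N. f x * f (x + 1))"
    using assms by (intro sum.mono_neutral_right) (auto simp: vanishes_beyond_def)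
  have "energy N f = (\<Sum>x=-N-1..N. (f (x + 1))\<^sup>2) + (\<Sum>x=-N-1..N. (f x)\<^sup>2)
      - 2 * (\<Sum>x=-N-1..N. f x * f (x + 1))"
    unfolding energy_def
    by (simp add: power2_diff sum.distrib sum_subtractf sum_distrib_left mult_ac)
  also have "\<dots> = 2 * (\<Sum>x=-N..N. (f x)\<^sup>2) - 2 * (\<Sum>x=-N..N. f x * f (x + 1))"
    unfolding sum_squares_shift[OF assms] cross by simp
  finally have "energy N f = \<dots>" .
  moreover have "(\<Sum>x=-N..N. f x * f (x - 1)) = (\<Sum>x=-N..N. f x * f (x + 1))"
    using shift_sum[OF assms assms] by (simp add: mult.commute)
  ultimately show ?thesis
    unfolding ip_lazy_step by (simp add: power2_eq_square field_simps)
qed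

text \<open>Laziness gives nonnegative spectrum: the energy is at most four times the unweighted
  square sum, which \<tau> \<ge> 1 bounds by \<open>ip N f f\<close>.\<close>

lemma ip_lazy_step_nonneg:
  assumes "vanishes_beyond N f"
  shows "0 \<le> ip N f (lazy_step f)"
proof -
  have sq: "(a - b)\<^sup>2 \<le> 2 * a\<^sup>2 + 2 * b\<^sup>2" for a b :: real
    using zero_le_power2[of "a + b"] by (simp add: power2_sum power2_diff)
  have "energy N f \<le> (\<Sum>x=-N-1..N. 2 * (f (x + 1))\<^sup>2 + 2 * (f x)\<^sup>2)"
    unfolding energy_def by (intro sum_mono sq)
  also have "\<dots> = 4 * (\<Sum>x=-N..N. (f x)\<^sup>2)"
    by (simp add: sum.distrib sum_distrib_left[symmetric] sum_squares_shift[OF assms])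
  also have "(\<Sum>x=-N..N. (f x)\<^sup>2) \<le> ip N f f"
    unfolding ip_def
  proof (rule sum_mono)
    fix x show "(f x)\<^sup>2 \<le> \<tau> x * f x * f x"
      using mult_right_mono[OF trap_ge_1[of x], of "(f x)\<^sup>2"] by (simp add: power2_eq_square mult_ac)
  qed
  finally show ?thesis
    using dirichlet_form[OF assms] by simp
qed

section \<open>The kernel of the lazy chain and its return probabilities\<close>

lemma vanishes_beyond_lazy_kernel: "vanishes_beyond (int n) (lazy_kernel n)"
proof (induction n)
  case 0
  show ?case by (simp add: vanishes_beyond_def lazy_kernel_def)
next
  case (Suc n)
  then show ?case
    using vanishes_beyond_step[of "int n" "lazy_kernel n"] by (simp add: lazy_kernel_def add.commute)
qed

lemma vanishes_beyond_lazy_kernel': "int n \<le> N \<Longrightarrow> vanishes_beyond N (lazy_kernel n)"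
  using vanishes_beyond_lazy_kernel vanishes_beyond_mono by blast

lemma lazy_kernel_Suc: "lazy_kernel (Suc n) = lazy_step (lazy_kernel n)"
  by (simp add: lazy_kernel_def)

lemma ip_lazy_kernel_0:
  assumes "0 \<le> N" shows "ip N (lazy_kernel 0) f = f 0"
proof -
  have "ip N (lazy_kernel 0) f = (\<Sum>x=-N..N. if x = 0 then f 0 else 0)"
    unfolding ip_def lazy_kernel_def by (intro sum.cong) auto
  then show ?thesis using assms by simp
qed

text \<open>Self-adjointness moves the \<open>n\<close> steps one by one from the kernel to
  \<open>f\<close>, and \<open>lazy_kernel 0\<close> evaluates at 0. Each move enlarges the support
  of \<open>f\<close> by one, whence the margin between \<open>M\<close> and
  \<open>N\<close>.\<close>

lemma ip_lazy_kernel_left: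
  "vanishes_beyond M f \<Longrightarrow> 0 \<le> M \<Longrightarrow> M + int n \<le> N \<Longrightarrow>
     ip N (lazy_kernel n) f = (lazy_step ^^ n) f 0"
proof (induction n arbitrary: f M)
  case 0
  then show ?case by (simp add: ip_lazy_kernel_0)
next
  case (Suc n)
  have "ip N (lazy_kernel (Suc n)) f = ip N (lazy_kernel n) (lazy_step f)"
    unfolding lazy_kernel_Suc using Suc.prems
    by (intro lazy_step_self_adjoint vanishes_beyond_lazy_kernel') (auto elim: vanishes_beyond_mono)
  also have "\<dots> = (lazy_step ^^ n) (lazy_step f) 0"
    using Suc.prems by (intro Suc.IH[of "M + 1"] vanishes_beyond_step) auto
  finally show ?case by (simp only: funpow_Suc_right o_apply)
qed

text \<open>The Chapman--Kolmogorov identity on the diagonal.\<close>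

lemma ip_lazy_kernel:
  "int (i + j) \<le> N \<Longrightarrow> ip N (lazy_kernel i) (lazy_kernel j) = lazy_kernel (i + j) 0"
  using ip_lazy_kernel_left[of "int j" "lazy_kernel j" i N] vanishes_beyond_lazy_kernel[of j]
  by (simp add: lazy_kernel_def funpow_add)

lemma lazy_kernel_nonneg: "0 \<le> lazy_kernel n x"
proof (induction n arbitrary: x)
  case 0
  show ?case using trap_pos[of 0] by (simp add: lazy_kernel_def)
next
  case (Suc n)
  have "lazy_step (\<lambda>_. 0) x \<le> lazy_step (lazy_kernel n) x"
    by (intro lazy_step_mono Suc.IH)
  then show ?case by (simp add: lazy_kernel_Suc lazy_step_def)
qed

text \<open>Multiplying a step by \<tau> leaves a pure second difference, whose sum telescopes away.
  One spare site at each end keeps the shifted sums from losing mass.\<close>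

lemma lazy_kernel_mass:
  assumes "int n \<le> N" shows "(\<Sum>x=-N..N. \<tau> x * lazy_kernel n x) = 1"
  using assms
proof (induction n)
  case 0
  have "(\<Sum>x=-N..N. \<tau> x * lazy_kernel 0 x) = (\<Sum>x=-N..N. if x = 0 then 1 else 0)"
    unfolding lazy_kernel_def by (intro sum.cong) auto
  then show ?case using 0 by simp
next
  case (Suc n)
  let ?f = "lazy_kernel n"
  have van: "vanishes_beyond (N - 1) ?f"
    using Suc.prems by (intro vanishes_beyond_lazy_kernel') simp
  have r: "(\<Sum>x=-N..N. ?f (x + 1)) = (\<Sum>x=-N..N. ?f x)"
  proof -
    have "(\<Sum>x=-N..N. ?f (x + 1)) = (\<Sum>x=-N+1..N+1. ?f x)"
      by (rule sum.reindex_bij_witness[where i = "\<lambda>x. x - 1" and j = "\<lambda>x. x + 1"]) auto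
    also have "\<dots> = (\<Sum>x=-N+1..N. ?f x)"
      using van by (intro sum.mono_neutral_right) (auto simp: vanishes_beyond_def)
    also have "\<dots> = (\<Sum>x=-N..N. ?f x)"
      using van by (intro sum.mono_neutral_left) (auto simp: vanishes_beyond_def)
    finally show ?thesis .
  qed
  have l: "(\<Sum>x=-N..N. ?f (x - 1)) = (\<Sum>x=-N..N. ?f x)"
  proof -
    have "(\<Sum>x=-N..N. ?f (x - 1)) = (\<Sum>x=-N-1..N-1. ?f x)"
      by (rule sum.reindex_bij_witness[where i = "\<lambda>x. x + 1" and j = "\<lambda>x. x - 1"]) auto
    also have "\<dots> = (\<Sum>x=-N..N-1. ?f x)"
      using van by (intro sum.mono_neutral_right) (auto simp: vanishes_beyond_def)
    also have "\<dots> = (\<Sum>x=-N..N. ?f x)"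
      using van by (intro sum.mono_neutral_left) (auto simp: vanishes_beyond_def)
    finally show ?thesis .
  qed
  have *: "\<tau> x * lazy_step ?f x = \<tau> x * ?f x + (?f (x + 1) + ?f (x - 1) - 2 * ?f x) / 4" for x
    by (simp add: lazy_step_def field_simps)
  have "(\<Sum>x=-N..N. \<tau> x * lazy_kernel (Suc n) x) = (\<Sum>x=-N..N. \<tau> x * ?f x)"
    unfolding lazy_kernel_Suc *
    by (simp add: sum.distrib sum_subtractf sum_divide_distrib[symmetric] sum_distrib_left[symmetric] r l)
  then show ?case using Suc by simp
qed

text \<open>With \<open>g\<close> the difference of the kernels at times \<open>i\<close> and
  \<open>i + 1\<close>, the second difference at time \<open>2 i\<close> is the norm of
  \<open>g\<close>, and at time \<open>2 i + 1\<close> it is \<open>g\<close> paired with its own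
  step. Laziness is what makes the latter nonnegative.\<close>

lemma on_diagonal_convex:
  "0 \<le> lazy_kernel n 0 - 2 * lazy_kernel (n + 1) 0 + lazy_kernel (n + 2) 0"
proof -
  define i where "i = n div 2"
  define N where "N = int (2 * n + 3)"
  define g where "g = (\<lambda>x. lazy_kernel i x - lazy_kernel (i + 1) x)"
  have van: "vanishes_beyond N g"
    unfolding g_def by (intro vanishes_beyond_diff vanishes_beyond_lazy_kernel') (auto simp: N_def i_def)
  have step: "lazy_step g = (\<lambda>x. lazy_kernel (i + 1) x - lazy_kernel (i + 2) x)"
    unfolding g_def by (auto simp: lazy_kernel_Suc lazy_step_def field_simps numeral_2_eq_2)
  have s: "int (i + i) \<le> N" "int (i + (i + 1)) \<le> N" "int (i + (i + 2)) \<le> N"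
    "int (i + 1 + i) \<le> N" "int (i + 1 + (i + 1)) \<le> N" "int (i + 1 + (i + 2)) \<le> N"
    by (auto simp: N_def i_def)
  show ?thesis
  proof (cases "even n")
    case True
    then have n: "n = i + i" by (auto simp: i_def)
    have "0 \<le> ip N g g" by (rule ip_nonneg)
    then show ?thesis
      unfolding g_def ip_diff_left ip_diff_right ip_lazy_kernel[OF s(1)] ip_lazy_kernel[OF s(2)]
        ip_lazy_kernel[OF s(4)] ip_lazy_kernel[OF s(5)] n
      by (simp add: numeral_2_eq_2)
  next
    case False
    then have n: "n = i + i + 1" unfolding i_def by presburger
    have "0 \<le> ip N g (lazy_step g)" by (rule ip_lazy_step_nonneg[OF van])
    then show ?thesis
      unfolding step unfolding g_def ip_diff_left ip_diff_right ip_lazy_kernel[OF s(2)] ip_lazy_kernel[OF s(3)]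
        ip_lazy_kernel[OF s(5)] ip_lazy_kernel[OF s(6)] n
      by (simp add: numeral_2_eq_2 numeral_3_eq_3)
  qed
qed

lemma energy_lazy_kernel:
  assumes "int (2 * n + 1) \<le> N"
  shows "energy N (lazy_kernel n) = 4 * (lazy_kernel (2 * n) 0 - lazy_kernel (2 * n + 1) 0)"
proof -
  have "energy N (lazy_kernel n) / 4 = ip N (lazy_kernel n) (lazy_kernel n) - ip N (lazy_kernel n) (lazy_kernel (n + 1))"
    using dirichlet_form[of N "lazy_kernel n"] assms vanishes_beyond_lazy_kernel'[of n N]
    by (simp add: lazy_kernel_Suc)
  also have "\<dots> = lazy_kernel (n + n) 0 - lazy_kernel (n + (n + 1)) 0"
    using assms by (subst (1 2) ip_lazy_kernel) auto
  finally show ?thesis by (simp add: mult_2)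
qed

lemma energy_nonneg: "0 \<le> energy N f"
  unfolding energy_def by (intro sum_nonneg) simp

text \<open>At even times the decrement is a quarter of an energy. At odd times convexity bounds it
  below by the following decrement, which starts at an even time.\<close>

lemma on_diagonal_antimono: "lazy_kernel (n + 1) 0 \<le> lazy_kernel n 0"
proof -
  have ev: "lazy_kernel (2 * i + 1) 0 \<le> lazy_kernel (2 * i) 0" for i
    using energy_lazy_kernel[of i "int (2 * i + 1)"] energy_nonneg[of "int (2 * i + 1)" "lazy_kernel i"]
    by simp
  show ?thesis
  proof (cases "even n")
    case True
    then show ?thesis using ev by (metis evenE)
  next
    case False
    then have "n + 1 = 2 * ((n + 1) div 2)" by presburger
    then have "lazy_kernel (n + 2) 0 \<le> lazy_kernel (n + 1) 0"
      using ev[of "(n + 1) div 2"] by (metis add.assoc one_add_one)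
    then show ?thesis using on_diagonal_convex[of n] by simp
  qed
qed

text \<open>Convexity makes the decrements nonincreasing, so the one at time \<open>n + j\<close> is
  at most the average of the \<open>j\<close> preceding ones, which telescope.\<close>

lemma on_diagonal_decrement:
  "real j * (lazy_kernel (n + j) 0 - lazy_kernel (n + j + 1) 0) \<le> lazy_kernel n 0 - lazy_kernel (n + j) 0"
proof (induction j)
  case 0
  show ?case by simp
next
  case (Suc j)
  let ?d = "\<lambda>k. lazy_kernel k 0 - lazy_kernel (k + 1) 0"
  have "?d (n + Suc j) \<le> ?d (n + j)"
    using on_diagonal_convex[of "n + j"] by simp
  then have "real (Suc j) * ?d (n + Suc j) \<le> real (Suc j) * ?d (n + j)"
    by (intro mult_left_mono) auto
  also have "\<dots> = real j * ?d (n + j) + ?d (n + j)"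
    by (simp add: algebra_simps)
  finally show ?case using Suc.IH by simp
qed

text \<open>The energy at time \<open>n\<close> is four times the decrement at time
  \<open>2 n\<close>; the previous bound with \<open>j = n\<close> controls it by the value at time
  \<open>n\<close>.\<close>

lemma energy_lazy_kernel_le:
  assumes "int (2 * n + 1) \<le> N"
  shows "real n * energy N (lazy_kernel n) \<le> 4 * lazy_kernel n 0"
  using on_diagonal_decrement[of n n] lazy_kernel_nonneg[of "n + n" 0]
  unfolding energy_lazy_kernel[OF assms] mult_2 by (simp add: algebra_simps)

text \<open>Telescoping over the edges between the two points, then Cauchy--Schwarz.\<close>

lemma increment_le_energy:
  assumes "a \<le> b" "- N \<le> a" "b \<le> N" "b - a \<le> int r"
  shows "(f b - f a)\<^sup>2 \<le> real r * energy N f"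
proof -
  have tele: "f b - f a = (\<Sum>x\<in>{a..<b}. f (x + 1) - f x)" for f :: "int \<Rightarrow> real"
    using \<open>a \<le> b\<close>
  proof (induction b rule: int_ge_induct)
    case base
    show ?case by simp
  next
    case (step b)
    have "{a..<b + 1} = insert b {a..<b}" using step.hyps by auto
    then show ?case using step.IH by simp
  qed
  have "(f b - f a)\<^sup>2 \<le> (\<Sum>x\<in>{a..<b}. (1::real)\<^sup>2) * (\<Sum>x\<in>{a..<b}. (f (x + 1) - f x)\<^sup>2)"
    unfolding tele using Cauchy_Schwarz_ineq_sum[of "\<lambda>_. 1" "\<lambda>x. f (x + 1) - f x" "{a..<b}"] by simp
  also have "\<dots> \<le> real r * energy N f"
    unfolding energy_def using assms
    by (intro mult_mono sum_mono2) (auto intro!: sum_nonneg)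
  finally show ?thesis .
qed

section \<open>Upper bound for the return density of the lazy chain\<close>

lemma on_diagonal_upper_aux:
  assumes "1 \<le> n" "1 \<le> r"
  shows "lazy_kernel n 0 \<le> 2 / volume r + 16 * real r / real n"
proof -
  let ?f = "lazy_kernel n"
  define N where "N = int (2 * n + 1 + r)"
  \<comment> \<open>Otherwise the ball alone would carry more than the total mass one.\<close>
  have "\<exists>y\<in>{-int r..int r}. ?f y \<le> 1 / volume r"
  proof (rule ccontr)
    assume "\<not> ?thesis"
    then have gt: "\<And>y. y \<in> {-int r..int r} \<Longrightarrow> \<tau> y * (1 / volume r) < \<tau> y * ?f y"
      using trap_pos by (intro mult_strict_left_mono) (auto simp: not_le)
    have "1 = (\<Sum>y=-int r..int r. \<tau> y * (1 / volume r))"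
      using volume_pos[of r] by (simp add: volume_def sum_divide_distrib[symmetric])
    also have "\<dots> < (\<Sum>y=-int r..int r. \<tau> y * ?f y)"
      by (rule sum_strict_mono) (use gt in auto)
    also have "\<dots> \<le> (\<Sum>y=-N..N. \<tau> y * ?f y)"
      by (intro sum_mono2) (auto simp: N_def intro!: mult_nonneg_nonneg lazy_kernel_nonneg less_imp_le[OF trap_pos])
    also have "\<dots> = 1"
      by (rule lazy_kernel_mass) (simp add: N_def)
    finally show False by simp
  qed
  then obtain y where y: "y \<in> {-int r..int r}" "?f y \<le> 1 / volume r" by blast
  have inc: "(?f 0 - ?f y)\<^sup>2 \<le> real r * energy N ?f"
    using increment_le_energy[of 0 y N r ?f] increment_le_energy[of y 0 N r ?f] y(1)
    by (cases "0 \<le> y") (auto simp: N_def power2_commute)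
  have en: "real n * energy N ?f \<le> 4 * ?f 0"
    by (rule energy_lazy_kernel_le) (simp add: N_def)
  show ?thesis
  \<comment> \<open>If the value at 0 exceeds \<open>2 / volume r\<close>, it drops by at least half
    on the way to \<open>y\<close>. Then \<open>(?f 0)\<^sup>2 / 4\<close> is at most
    \<open>r\<close> times the energy, hence at most \<open>4 r ?f 0 / n\<close>, which yields the
    constant 16.\<close>
  proof (cases "?f 0 \<le> 2 / volume r")
    case True
    have "0 \<le> 16 * real r / real n" by simp
    then show ?thesis using True by linarith
  next
    case False
    then have half: "?f 0 / 2 \<le> ?f 0 - ?f y" and pos: "0 < ?f 0"
    proof -
      have "2 * ?f y \<le> 2 / volume r" "0 < 2 / volume r" using y(2) volume_pos[of r] by auto
      then show "?f 0 / 2 \<le> ?f 0 - ?f y" "0 < ?f 0" using False by linarith+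
    qed
    have "(?f 0 / 2)\<^sup>2 \<le> (?f 0 - ?f y)\<^sup>2"
      using half pos by (intro power_mono) auto
    also note inc
    finally have "real n * (?f 0 / 2)\<^sup>2 \<le> real r * (real n * energy N ?f)"
      using assms by (simp add: mult_left_mono mult.left_commute)
    also have "\<dots> \<le> real r * (4 * ?f 0)"
      using en by (intro mult_left_mono) auto
    finally have "real n * ?f 0 \<le> 16 * real r"
      using pos by (simp add: power2_eq_square field_simps)
    then have "?f 0 \<le> 16 * real r / real n"
      using assms by (simp add: field_simps)
    moreover have "0 \<le> 2 / volume r" using volume_pos[of r] by simp
    ultimately show ?thesis by linarith
  qed
qed

lemma on_diagonal_le_1: "lazy_kernel n 0 \<le> 1"
proof (induction n)
  case 0
  show ?case using trap_ge_1[of 0] by (simp add: lazy_kernel_def)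
next
  case (Suc n)
  then show ?case using on_diagonal_antimono[of n] by simp
qed

text \<open>Doubling the constant allows the denominator \<open>n + 1\<close>, which is also
  meaningful at time 0 and matches the Poisson weights used later.\<close>

lemma on_diagonal_upper:
  assumes "1 \<le> r"
  shows "lazy_kernel n 0 \<le> 2 / volume r + 32 * real r / real (n + 1)"
proof (cases "n = 0")
  case True
  have "lazy_kernel n 0 \<le> 32 * real r"
    using on_diagonal_le_1[of n] assms by linarith
  moreover have "0 < 2 / volume r" using volume_pos[of r] by simp
  moreover have "32 * real r / real (n + 1) = 32 * real r" using True by simp
  ultimately show ?thesis by linarith
next
  case False
  then have "16 * real r / real n \<le> 32 * real r / real (n + 1)"
    using mult_left_mono[of "real n + 1" "2 * real n" "16 * real r"] by (simp add: divide_simps algebra_simps)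
  then show ?thesis
    using on_diagonal_upper_aux[of n r] False assms by linarith
qed


section \<open>Lower bound for the return density by a subeigenfunction\<close>

definition bump :: "nat \<Rightarrow> int \<Rightarrow> real" where
  "bump m x = (\<Sum>z=-int m..int m. \<tau> z * of_int (max 0 (4 * int m - \<bar>x - z\<bar>)))"

lemma bump_nonneg: "0 \<le> bump m x"
  unfolding bump_def by (intro sum_nonneg mult_nonneg_nonneg less_imp_le[OF trap_pos]) simp

lemma bump_le: "bump m x \<le> 4 * real m * volume m"
proof -
  have "bump m x \<le> (\<Sum>z=-int m..int m. \<tau> z * of_int (4 * int m))"
    unfolding bump_def by (intro sum_mono mult_left_mono less_imp_le[OF trap_pos] of_int_le_iff[THEN iffD2]) simp
  then show ?thesis by (simp add: volume_def sum_distrib_right[symmetric] mult.commute)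
qed

text \<open>Two points of the ball are at distance at most \<open>2 m\<close>, so every tent, of
  height \<open>4 m\<close>, still has height at least \<open>2 m\<close> there. Thus on the ball
  the bump is at least half of the upper bound in \<open>bump_le\<close>.\<close>

lemma bump_ge:
  assumes "\<bar>x\<bar> \<le> int m" shows "2 * real m * volume m \<le> bump m x"
proof -
  have "(\<Sum>z=-int m..int m. \<tau> z * of_int (2 * int m)) \<le> bump m x"
    unfolding bump_def using assms
    by (intro sum_mono mult_left_mono less_imp_le[OF trap_pos] of_int_le_iff[THEN iffD2]) auto
  then show ?thesis by (simp add: volume_def sum_distrib_right[symmetric] mult.commute)
qed

lemma vanishes_beyond_bump: "vanishes_beyond (int (5 * m)) (bump m)"
  unfolding vanishes_beyond_def bump_def by (auto intro!: sum.neutral)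

text \<open>A tent of slope one has second difference at least -2 at its apex and at least 0
  elsewhere, the kinks at its feet being convex. Hence only the tent centred at \<open>x\<close> can
  bend the sum downwards at \<open>x\<close>.\<close>

lemma bump_second_difference:
  "(if \<bar>x\<bar> \<le> int m then - 2 * \<tau> x else 0) \<le> bump m (x + 1) + bump m (x - 1) - 2 * bump m x"
proof -
  define tent where "tent = (\<lambda>k. max 0 (4 * int m - \<bar>k\<bar>))"
  have convex: "(if k = 0 then - 2 else 0) \<le> max 0 (a - \<bar>k + 1\<bar>) + max 0 (a - \<bar>k - 1\<bar>) - 2 * max 0 (a - \<bar>k\<bar>)"
    for a k :: int
    by (cases "k = 0") (simp_all add: max_def abs_if split del: if_split, (simp split: if_split; linarith)+)
  have tent: "(if x = z then - 2 else 0) \<le> tent (x + 1 - z) + tent (x - 1 - z) - 2 * tent (x - z)" for z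
    using convex[of "x - z" "4 * int m"] unfolding tent_def by (simp add: algebra_simps)
  have "(if \<bar>x\<bar> \<le> int m then - 2 * \<tau> x else 0)
      = (\<Sum>z=-int m..int m. if z = x then - 2 * \<tau> x else 0)"
    by auto
  also have "\<dots> = (\<Sum>z=-int m..int m. \<tau> z * of_int (if x = z then - 2 else 0))"
    by (intro sum.cong) auto
  also have "\<dots> \<le> (\<Sum>z=-int m..int m. \<tau> z * of_int (tent (x + 1 - z) + tent (x - 1 - z) - 2 * tent (x - z)))"
    by (intro sum_mono mult_left_mono less_imp_le[OF trap_pos] of_int_le_iff[THEN iffD2] tent)
  also have "\<dots> = bump m (x + 1) + bump m (x - 1) - 2 * bump m x"
  proof -
    have "\<tau> z * of_int (a + b - 2 * c) = \<tau> z * of_int a + \<tau> z * of_int b - 2 * (\<tau> z * of_int c)"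
      for z a b c
      by (simp add: algebra_simps)
    then show ?thesis
      by (simp only: bump_def tent_def sum.distrib sum_subtractf sum_distrib_left)
  qed
  finally show ?thesis .
qed

text \<open>The bending \<open>- 2 * \<tau> x\<close> divided by \<open>4 * \<tau> x\<close> is -1/2
  whatever the depth, and by \<open>bump_ge\<close> this is a small fraction of the bump. Outside
  the ball nothing is lost.\<close>

lemma bump_lazy_step:
  assumes "1 \<le> m"
  shows "(1 - 1 / (4 * real m * volume m)) * bump m x \<le> lazy_step (bump m) x"
proof (cases "\<bar>x\<bar> \<le> int m")
  case True
  have "- 2 * \<tau> x / (4 * \<tau> x) \<le> (bump m (x + 1) + bump m (x - 1) - 2 * bump m x) / (4 * \<tau> x)"
    using bump_second_difference[of x m] True trap_pos[of x] by (intro divide_right_mono) auto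
  moreover have "1 / 2 \<le> bump m x / (4 * real m * volume m)"
    using bump_ge[OF True] assms volume_pos[of m] by (simp add: field_simps)
  ultimately show ?thesis by (simp add: lazy_step_def left_diff_distrib)
next
  case False
  have "0 \<le> (bump m (x + 1) + bump m (x - 1) - 2 * bump m x) / (4 * \<tau> x)"
    using bump_second_difference[of x m] False trap_pos[of x] by (intro divide_nonneg_pos) auto
  moreover have "0 \<le> 1 / (4 * real m * volume m) * bump m x"
    using volume_pos[of m] bump_nonneg[of m x] by simp
  ultimately show ?thesis by (simp add: lazy_step_def left_diff_distrib)
qed

lemma lazy_step_scale: "lazy_step (\<lambda>y. c * f y) x = c * lazy_step f x"
  by (simp add: lazy_step_def field_simps)

lemma lazy_step_funpow_subeigenfunction:
  assumes "\<And>x. \<mu> * h x \<le> lazy_step h x" "0 \<le> \<mu>"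
  shows "\<mu> ^ n * h x \<le> (lazy_step ^^ n) h x"
proof (induction n arbitrary: x)
  case 0
  show ?case by simp
next
  case (Suc n)
  have "\<mu> ^ Suc n * h x = \<mu> ^ n * (\<mu> * h x)" by (simp add: mult_ac)
  also have "\<dots> \<le> \<mu> ^ n * lazy_step h x"
    using assms by (intro mult_left_mono) auto
  also have "\<dots> = lazy_step (\<lambda>y. \<mu> ^ n * h y) x"
    by (simp add: lazy_step_scale)
  also have "\<dots> \<le> lazy_step ((lazy_step ^^ n) h) x"
    by (intro lazy_step_mono Suc.IH)
  finally show ?case by simp
qed

text \<open>Cauchy--Schwarz with the square root of the depth split off; the squared norm of the
  kernel is the return density at twice the time.\<close>

lemma mass_on_ball_le:
  assumes "int (n + n + R) \<le> N"
  shows "(\<Sum>x=-int R..int R. \<tau> x * lazy_kernel n x)\<^sup>2 \<le> volume R * lazy_kernel (n + n) 0"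
proof -
  let ?f = "lazy_kernel n"
  have nn: "0 \<le> \<tau> x" for x using trap_pos[of x] by simp
  have "(\<Sum>x=-int R..int R. \<tau> x * ?f x)\<^sup>2 = (\<Sum>x=-int R..int R. sqrt (\<tau> x) * (sqrt (\<tau> x) * ?f x))\<^sup>2"
    by (simp add: mult.assoc[symmetric] nn)
  also have "\<dots> \<le> (\<Sum>x=-int R..int R. (sqrt (\<tau> x))\<^sup>2) * (\<Sum>x=-int R..int R. (sqrt (\<tau> x) * ?f x)\<^sup>2)"
    by (rule Cauchy_Schwarz_ineq_sum)
  also have "\<dots> = volume R * (\<Sum>x=-int R..int R. \<tau> x * ?f x * ?f x)"
    by (simp add: volume_def power_mult_distrib nn power2_eq_square[of "lazy_kernel n _"] mult.assoc)
  also have "\<dots> \<le> volume R * ip N ?f ?f"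
    unfolding ip_def using assms
    by (intro mult_left_mono sum_mono2 less_imp_le[OF volume_pos])
       (auto intro!: mult_nonneg_nonneg nn lazy_kernel_nonneg)
  also have "ip N ?f ?f = lazy_kernel (n + n) 0"
    using assms by (intro ip_lazy_kernel) simp
  finally show ?thesis .
qed

lemma on_diagonal_lower_even:
  assumes "1 \<le> m"
  shows "(1 - 1 / (4 * real m * volume m)) ^ (2 * n) / (4 * volume (5 * m)) \<le> lazy_kernel (2 * n) 0"
proof -
  let ?f = "lazy_kernel n"
  define N where "N = int (n + n + 5 * m)"
  define \<mu> where "\<mu> = 1 - 1 / (4 * real m * volume m)"
  define S where "S = (\<Sum>x=-int (5*m)..int (5*m). \<tau> x * ?f x)"
  have "1 \<le> 4 * real m * volume m"
    using mult_mono[of 1 "4 * real m" 1 "volume m"] assms volume_ge[of m] by simp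
  then have \<mu>: "0 \<le> \<mu>" by (simp add: \<mu>_def)
  have mV: "0 < real m * volume m" using assms volume_pos[of m] by simp
  \<comment> \<open>The bump lives on radius \<open>5 m\<close>, the ball \<open>m\<close> plus the
    tent width \<open>4 m\<close>. Pairing it with the kernel, using its lower bound at 0 and its
    global upper bound, shows that the ball of radius \<open>5 m\<close> keeps mass at least
    \<open>\<mu> ^ n / 2\<close>.\<close>
  have "\<mu> ^ n * (2 * real m * volume m) \<le> \<mu> ^ n * bump m 0"
    using \<mu> by (intro mult_left_mono bump_ge) auto
  also have "\<dots> \<le> (lazy_step ^^ n) (bump m) 0"
    using bump_lazy_step[OF assms] \<mu> by (intro lazy_step_funpow_subeigenfunction) (auto simp: \<mu>_def)
  also have "\<dots> = ip N ?f (bump m)"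
    by (rule ip_lazy_kernel_left[symmetric, OF vanishes_beyond_bump]) (auto simp: N_def)
  also have "\<dots> = (\<Sum>x=-int (5*m)..int (5*m). \<tau> x * ?f x * bump m x)"
    unfolding ip_def using vanishes_beyond_bump[of m]
    by (intro sum.mono_neutral_right) (auto simp: N_def vanishes_beyond_def)
  also have "\<dots> \<le> (\<Sum>x=-int (5*m)..int (5*m). \<tau> x * ?f x * (4 * real m * volume m))"
    by (intro sum_mono mult_left_mono bump_le mult_nonneg_nonneg lazy_kernel_nonneg less_imp_le[OF trap_pos])
  also have "\<dots> = S * (4 * real m * volume m)"
    by (simp add: S_def sum_distrib_right)
  finally have "(\<mu> ^ n / 2) * (4 * (real m * volume m)) \<le> S * (4 * (real m * volume m))"
    by (simp add: mult_ac)
  then have "\<mu> ^ n / 2 \<le> S" using mV by (subst (asm) mult_le_cancel_right_pos) auto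
  then have "(\<mu> ^ n / 2)\<^sup>2 \<le> S\<^sup>2" using \<mu> by (intro power_mono) auto
  also have "\<dots> \<le> volume (5 * m) * lazy_kernel (n + n) 0"
    unfolding S_def by (rule mass_on_ball_le[of _ _ N]) (simp add: N_def)
  finally have "\<mu> ^ (2 * n) / 4 \<le> volume (5 * m) * lazy_kernel (2 * n) 0"
    unfolding mult_2[of n] by (simp add: power_divide power2_eq_square power_add)
  then show ?thesis
    using volume_pos[of "5 * m"] by (simp add: \<mu>_def field_simps)
qed

text \<open>Monotonicity reduces to the even time among \<open>n\<close> and \<open>n + 1\<close>.
  The possible extra factor is at least 1/2, which turns 4 into 8.\<close>

lemma on_diagonal_lower:
  assumes "1 \<le> m"
  shows "(1 - 1 / (4 * real m * volume m)) ^ n / (8 * volume (5 * m)) \<le> lazy_kernel n 0"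
proof -
  define \<mu> where "\<mu> = 1 - 1 / (4 * real m * volume m)"
  have "4 * 1 \<le> 4 * (real m * volume m)"
    using mult_mono[of 1 "real m" 1 "volume m"] assms volume_ge[of m] by simp
  then have \<mu>: "1 / 2 \<le> \<mu>" "\<mu> \<le> 1" using volume_pos[of m] assms by (auto simp: \<mu>_def field_simps)
  define k where "k = (n + 1) div 2"
  have "\<mu> ^ n / 2 \<le> \<mu> ^ (n + 1)"
    using mult_right_mono[OF \<mu>(1), of "\<mu> ^ n"] \<mu> by simp
  also have "\<dots> \<le> \<mu> ^ (2 * k)"
    using \<mu> by (intro power_decreasing) (auto simp: k_def)
  finally have "\<mu> ^ n / 2 / (4 * volume (5 * m)) \<le> \<mu> ^ (2 * k) / (4 * volume (5 * m))"
    using volume_pos[of "5 * m"] by (intro divide_right_mono) auto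
  also have "\<dots> \<le> lazy_kernel (2 * k) 0"
    unfolding \<mu>_def by (rule on_diagonal_lower_even[OF assms])
  also have "\<dots> \<le> lazy_kernel n 0"
  proof -
    have "2 * k = n \<or> 2 * k = n + 1" unfolding k_def by presburger
    then show ?thesis using on_diagonal_antimono[of n] by auto
  qed
  finally show ?thesis by (simp add: \<mu>_def)
qed

section \<open>Uniformisation: from the lazy chain to continuous time\<close>

lemma bt_Lpow_Suc:
  "bt_Lpow \<tau> (Suc k) x y =
     (bt_Lpow \<tau> k (x + 1) y + bt_Lpow \<tau> k (x - 1) y - 2 * bt_Lpow \<tau> k x y) / (2 * \<tau> x)"
  by (simp add: bt_rate_def field_simps)

text \<open>The absolute row sums of the generator are \<open>2 / \<tau> x\<close>, at most 2. This
  makes the exponential series absolutely convergent.\<close>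

lemma abs_bt_Lpow_le: "\<bar>bt_Lpow \<tau> k x y\<bar> \<le> 2 ^ k"
proof (induction k arbitrary: x)
  case 0
  show ?case by simp
next
  case (Suc k)
  have "\<bar>bt_Lpow \<tau> (Suc k) x y\<bar> =
      \<bar>bt_Lpow \<tau> k (x + 1) y + bt_Lpow \<tau> k (x - 1) y - 2 * bt_Lpow \<tau> k x y\<bar> / (2 * \<tau> x)"
    unfolding bt_Lpow_Suc using trap_pos[of x] by simp
  also have "\<dots> \<le> 4 * 2 ^ k / (2 * 1)"
    using Suc.IH[of "x + 1"] Suc.IH[of "x - 1"] Suc.IH[of x] trap_ge_1[of x]
    by (intro frac_le) auto
  finally show ?case by simp
qed

lemma sum_choose_Suc:
  fixes a :: "nat \<Rightarrow> real"
  shows "(\<Sum>k\<le>Suc n. real (Suc n choose k) * a k) = (\<Sum>k\<le>n. real (n choose k) * (a k + a (Suc k)))"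
proof -
  have "(\<Sum>k\<le>Suc n. real (Suc n choose k) * a k)
      = a 0 + (\<Sum>k\<le>n. real (n choose Suc k) * a (Suc k)) + (\<Sum>k\<le>n. real (n choose k) * a (Suc k))"
    by (simp add: sum.atMost_Suc_shift sum.distrib distrib_right del: sum.atMost_Suc)
  also have "a 0 + (\<Sum>k\<le>n. real (n choose Suc k) * a (Suc k)) = (\<Sum>k\<le>Suc n. real (n choose k) * a k)"
    by (simp add: sum.atMost_Suc_shift del: sum.atMost_Suc)
  finally show ?thesis by (simp add: sum.distrib distrib_left)
qed

text \<open>Binomial expansion of the powers of \<open>I + L/2\<close>; the induction step is
  Pascal's rule in the form \<open>sum_choose_Suc\<close>.\<close>

lemma lazy_kernel_binomial:
  "lazy_kernel n x = (\<Sum>k\<le>n. real (n choose k) * (bt_Lpow \<tau> k x 0 / 2 ^ k)) / \<tau> 0"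
proof (induction n arbitrary: x)
  case 0
  show ?case by (simp add: lazy_kernel_def)
next
  case (Suc n)
  let ?l = "\<lambda>k x. bt_Lpow \<tau> k x 0 / 2 ^ k"
  have Suc_l: "?l (Suc k) x = (?l k (x + 1) + ?l k (x - 1) - 2 * ?l k x) / (4 * \<tau> x)" for k
    unfolding bt_Lpow_Suc by (simp add: field_simps)
  have "(\<Sum>k\<le>n. real (n choose k) * (?l k x + ?l (Suc k) x)) =
      (\<Sum>k\<le>n. real (n choose k) * ?l k x +
        (real (n choose k) * ?l k (x + 1) + real (n choose k) * ?l k (x - 1)
          - 2 * (real (n choose k) * ?l k x)) / (4 * \<tau> x))"
    unfolding Suc_l by (intro sum.cong refl) (simp add: divide_simps, simp add: algebra_simps)
  also have "\<dots> = \<tau> 0 * lazy_step (lazy_kernel n) x"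
    unfolding lazy_step_def Suc.IH
    by (simp only: sum.distrib sum_subtractf sum_divide_distrib[symmetric] sum_distrib_left[symmetric])
       (simp add: field_simps)
  finally show ?case
    unfolding sum_choose_Suc lazy_kernel_Suc by simp
qed

text \<open>Since \<open>L = 2 (P - I)\<close> for the lazy chain \<open>P\<close>,
  \<open>exp (2 t) exp (t L) = exp (2 t P)\<close>. In series form this is the Cauchy product of the
  two exponential series combined with the binomial expansion.\<close>

lemma heat_kernel_poissonisation:
  "(\<lambda>n. (2 * t) ^ n / fact n * lazy_kernel n 0) sums (exp (2 * t) * bt_heat_kernel \<tau> t 0 0)"
proof -
  define a where "a = (\<lambda>k. t ^ k / fact k * bt_Lpow \<tau> k 0 0)"
  define b where "b = (\<lambda>k. (2 * t) ^ k / fact k)"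
  have bs: "(\<lambda>k. x ^ k / fact k) sums exp x" for x :: real
    using exp_converges[of x] by (simp add: field_simps)
  have b: "suminf b = exp (2 * t)" unfolding b_def using bs by (rule sums_unique[symmetric])
  have absb: "norm (b k) = (2 * \<bar>t\<bar>) ^ k / fact k" for k
    by (simp add: b_def power_abs abs_mult)
  have nb: "summable (\<lambda>k. norm (b k))"
    unfolding absb using bs by (rule sums_summable)
  have na: "summable (\<lambda>k. norm (a k))"
  proof (rule summable_comparison_test'[OF nb, of 0])
    fix k
    have "\<bar>t\<bar> ^ k / fact k * \<bar>bt_Lpow \<tau> k 0 0\<bar> \<le> \<bar>t\<bar> ^ k / fact k * 2 ^ k"
      by (intro mult_left_mono abs_bt_Lpow_le) auto
    then show "norm (norm (a k)) \<le> norm (b k)"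
      unfolding absb by (simp add: a_def abs_mult power_abs power_mult_distrib mult_ac)
  qed
  have "(\<Sum>i\<le>n. a i * b (n - i)) = (2 * t) ^ n / fact n * (\<tau> 0 * lazy_kernel n 0)" for n
  proof -
    have "a i * b (n - i) = (2 * t) ^ n / fact n * (real (n choose i) * (bt_Lpow \<tau> i 0 0 / 2 ^ i))"
      if "i \<le> n" for i
    proof -
      have pow: "(2 * t) ^ n = 2 ^ i * t ^ i * (2 * t) ^ (n - i)"
        unfolding power_mult_distrib[of 2 t i, symmetric] power_add[symmetric] using that by simp
      have "a i * b (n - i) = t ^ i * (2 * t) ^ (n - i) * bt_Lpow \<tau> i 0 0 * (1 / (fact i * fact (n - i)))"
        by (simp add: a_def b_def)
      also have "1 / (fact i * fact (n - i)) = real (n choose i) / fact n"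
        unfolding binomial_fact[OF that, where 'a = real] by simp
      finally show ?thesis
        unfolding pow by simp
    qed
    then have "(\<Sum>i\<le>n. a i * b (n - i))
        = (2 * t) ^ n / fact n * (\<Sum>i\<le>n. real (n choose i) * (bt_Lpow \<tau> i 0 0 / 2 ^ i))"
      unfolding sum_distrib_left by (intro sum.cong) auto
    also have "(\<Sum>i\<le>n. real (n choose i) * (bt_Lpow \<tau> i 0 0 / 2 ^ i)) = \<tau> 0 * lazy_kernel n 0"
      unfolding lazy_kernel_binomial by simp
    finally show ?thesis .
  qed
  then have "(\<lambda>n. (2 * t) ^ n / fact n * (\<tau> 0 * lazy_kernel n 0)) sums (suminf a * exp (2 * t))"
    using Cauchy_product_sums[OF na nb] by (simp add: b)
  then have "(\<lambda>n. (2 * t) ^ n / fact n * (\<tau> 0 * lazy_kernel n 0) / \<tau> 0) sums (suminf a * exp (2 * t) / \<tau> 0)"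
    by (rule sums_divide)
  then show ?thesis
    by (simp add: bt_heat_kernel_def bt_trans_def a_def mult_ac)
qed

lemma poisson_weights_sums: "(\<lambda>n. c * ((x * y) ^ n / fact n)) sums (c * exp (x * y :: real))"
  using exp_converges[of "x * y"] by (intro sums_mult) (simp add: field_simps)

lemma heat_kernel_nonneg: "0 \<le> t \<Longrightarrow> 0 \<le> bt_heat_kernel \<tau> t 0 0"
  using sums_le[OF _ sums_zero heat_kernel_poissonisation[of t]] lazy_kernel_nonneg
  by (simp add: zero_le_mult_iff)

lemma heat_kernel_le_1:
  assumes "0 \<le> t" shows "bt_heat_kernel \<tau> t 0 0 \<le> 1"
proof -
  have "exp (2 * t) * bt_heat_kernel \<tau> t 0 0 \<le> 1 * exp (2 * t)"
  proof (rule sums_le[OF _ heat_kernel_poissonisation poisson_weights_sums])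
    fix n show "(2 * t) ^ n / fact n * lazy_kernel n 0 \<le> 1 * ((2 * t) ^ n / fact n)"
      using mult_left_mono[OF on_diagonal_le_1[of n], of "(2 * t) ^ n / fact n"] assms by simp
  qed
  then show ?thesis by simp
qed

text \<open>Dividing the Poisson weight of \<open>n\<close> by \<open>n + 1\<close> gives the weight
  of \<open>n + 1\<close> divided by \<open>2 t\<close>, so averaging turns
  \<open>32 r / (n + 1)\<close> into at most \<open>16 r / t\<close>.\<close>

lemma heat_kernel_upper:
  assumes "0 < t" "1 \<le> r"
  shows "bt_heat_kernel \<tau> t 0 0 \<le> 2 / volume r + 16 * real r / t"
proof -
  let ?w = "\<lambda>n. (2 * t) ^ n / fact n"
  have w: "?w sums exp (2 * t)" using poisson_weights_sums[of 1 2 t] by simp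
  have "(\<lambda>n. ?w (Suc n)) sums (exp (2 * t) - 1)"
    using w by (subst sums_Suc_iff) simp
  then have "(\<lambda>n. 16 * real r / t * ?w (Suc n)) sums (16 * real r / t * (exp (2 * t) - 1))"
    by (rule sums_mult)
  from sums_add[OF poisson_weights_sums[of "2 / volume r" 2 t] this]
  have "(\<lambda>n. 2 / volume r * ?w n + 16 * real r / t * ?w (Suc n)) sums
      (2 / volume r * exp (2 * t) + 16 * real r / t * (exp (2 * t) - 1))" .
  moreover have "?w n * lazy_kernel n 0 \<le> 2 / volume r * ?w n + 16 * real r / t * ?w (Suc n)" for n
  proof -
    have "?w n * lazy_kernel n 0 \<le> ?w n * (2 / volume r + 32 * real r / real (n + 1))"
      using assms by (intro mult_left_mono on_diagonal_upper) auto
    also have "\<dots> = 2 / volume r * ?w n + 16 * real r / t * ?w (Suc n)"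
    proof -
      have "?w n * (32 * real r / real (n + 1)) = 16 * real r / t * ?w (Suc n)"
        using assms by (simp add: divide_simps del: of_nat_Suc)
      then show ?thesis by (simp add: distrib_left mult.commute)
    qed
    finally show ?thesis .
  qed
  ultimately have "exp (2 * t) * bt_heat_kernel \<tau> t 0 0
      \<le> 2 / volume r * exp (2 * t) + 16 * real r / t * (exp (2 * t) - 1)"
    by (intro sums_le[OF _ heat_kernel_poissonisation[of t]])
  also have "\<dots> \<le> 2 / volume r * exp (2 * t) + 16 * real r / t * exp (2 * t)"
    using assms by (intro add_left_mono mult_left_mono) auto
  also have "\<dots> = exp (2 * t) * (2 / volume r + 16 * real r / t)"
    by (simp add: algebra_simps)
  finally show ?thesis by simp
qed

text \<open>The Poisson average of \<open>\<mu> ^ n\<close> with mean \<open>2 t\<close> is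
  \<open>exp (- 2 t (1 - \<mu>))\<close>, and \<open>2 t (1 - \<mu>)\<close> equals
  \<open>t / (2 m V)\<close>.\<close>

lemma heat_kernel_lower:
  assumes "0 < t" "1 \<le> m"
  shows "exp (- t / (2 * real m * volume m)) / (8 * volume (5 * m)) \<le> bt_heat_kernel \<tau> t 0 0"
proof -
  define \<mu> where "\<mu> = 1 - 1 / (4 * real m * volume m)"
  have "1 / (8 * volume (5 * m)) * exp (2 * t * \<mu>) \<le> exp (2 * t) * bt_heat_kernel \<tau> t 0 0"
  proof (rule sums_le[OF _ poisson_weights_sums heat_kernel_poissonisation])
    fix n
    have "(2 * t) ^ n / fact n * (\<mu> ^ n / (8 * volume (5 * m))) \<le> (2 * t) ^ n / fact n * lazy_kernel n 0"
      using assms on_diagonal_lower[OF assms(2)] by (intro mult_left_mono) (auto simp: \<mu>_def)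
    then show "1 / (8 * volume (5 * m)) * ((2 * t * \<mu>) ^ n / fact n) \<le> (2 * t) ^ n / fact n * lazy_kernel n 0"
      by (simp add: power_mult_distrib mult_ac)
  qed
  moreover have "exp (2 * t * \<mu>) = exp (2 * t) * exp (- t / (2 * real m * volume m))"
    by (simp add: \<mu>_def exp_add[symmetric] right_diff_distrib)
  ultimately have "exp (2 * t) * (exp (- t / (2 * real m * volume m)) / (8 * volume (5 * m)))
      \<le> exp (2 * t) * bt_heat_kernel \<tau> t 0 0"
    by simp
  then show ?thesis by (simp only: mult_le_cancel_left_pos exp_gt_zero)
qed

end

section \<open>Volume of balls in a Pareto environment\<close>

lemma measurable_bt_Lpow:
  assumes [measurable]: "\<And>x. (\<lambda>\<omega>. \<tau> \<omega> x) \<in> borel_measurable M"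
  shows "(\<lambda>\<omega>. bt_Lpow (\<tau> \<omega>) n x y) \<in> borel_measurable M"
proof (induction n arbitrary: x)
  case 0
  show ?case by simp
next
  case (Suc n)
  note Suc[measurable]
  have [measurable]: "(\<lambda>\<omega>. bt_rate (\<tau> \<omega>) x z) \<in> borel_measurable M" for z
    unfolding bt_rate_def by measurable
  show ?case unfolding bt_Lpow.simps by measurable
qed

lemma measurable_bt_heat_kernel:
  assumes [measurable]: "\<And>x. (\<lambda>\<omega>. \<tau> \<omega> x) \<in> borel_measurable M"
  shows "(\<lambda>\<omega>. bt_heat_kernel (\<tau> \<omega>) t x y) \<in> borel_measurable M"
proof -
  note measurable_bt_Lpow[OF assms, measurable]
  show ?thesis unfolding bt_heat_kernel_def bt_trans_def by measurable
qed

text \<open>A step function comparable to \<open>min x (2 ^ n)\<close> for \<open>x\<close> at least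
  1. Built from tail indicators, its mean is read off the tail assumption without densities.\<close>

definition dyadic_count :: "nat \<Rightarrow> real \<Rightarrow> real" where
  "dyadic_count n x = (\<Sum>k\<le>n. 2 ^ k * indicator {2 ^ k<..} x)"

lemma measurable_dyadic_count [measurable]: "dyadic_count n \<in> borel_measurable borel"
  unfolding dyadic_count_def[abs_def] by measurable

lemma dyadic_count_nonneg: "0 \<le> dyadic_count n x"
  unfolding dyadic_count_def by (intro sum_nonneg) simp

lemma dyadic_count_Suc:
  "dyadic_count (Suc n) x = dyadic_count n x + (if 2 ^ Suc n < x then 2 ^ Suc n else 0)"
  by (simp add: dyadic_count_def)

lemma dyadic_count_lt: "dyadic_count n x < 2 ^ Suc n"
proof (induction n)
  case (Suc n)
  then show ?case by (auto simp: dyadic_count_Suc intro: less_trans[of _ "2 * 2 ^ n"])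
qed (auto simp: dyadic_count_def indicator_def)

lemma dyadic_count_ge: "1 \<le> x \<Longrightarrow> min x (2 ^ Suc n) \<le> 1 + dyadic_count n x"
proof (induction n)
  case 0
  then show ?case by (auto simp: dyadic_count_def indicator_def)
next
  case (Suc n)
  then show ?case
    by (cases "x \<le> 2 ^ Suc n") (auto simp: dyadic_count_Suc min_def split: if_splits)
qed

lemma dyadic_count_le: "1 \<le> x \<Longrightarrow> dyadic_count n x \<le> 2 * min x (2 ^ n)"
proof (induction n)
  case 0
  then show ?case by (auto simp: dyadic_count_def indicator_def)
next
  case (Suc n)
  show ?case
  proof (cases "x \<le> 2 ^ Suc n")
    case True
    then have "dyadic_count (Suc n) x = dyadic_count n x" by (simp add: dyadic_count_Suc)
    also have "\<dots> \<le> 2 * min x (2 ^ n)" by (intro Suc)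
    also have "\<dots> \<le> 2 * min x (2 ^ Suc n)" by (intro mult_left_mono min.mono) auto
    finally show ?thesis .
  next
    case False
    then show ?thesis using dyadic_count_lt[of "Suc n" x] by simp
  qed
qed

text \<open>Bounds a Laplace transform by a truncated mean; it follows from
  \<open>exp (- y) \<le> 1 / (1 + y)\<close>.\<close>

lemma exp_minus_le_min:
  fixes y :: real
  assumes "0 \<le> y" shows "exp (- y) \<le> 1 - min y 1 / 2"
proof -
  have "exp (- y) \<le> 1 / (1 + y)"
    using exp_ge_add_one_self[of y] assms by (simp add: exp_minus field_simps)
  also have "\<dots> \<le> 1 - min y 1 / 2"
  proof (cases "y \<le> 1")
    case True
    then have "0 \<le> y * (1 - y)" using assms by simp
    then show ?thesis using True assms by (simp add: field_simps)
  next
    case False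
    then show ?thesis by (simp add: field_simps)
  qed
  finally show ?thesis .
qed

text \<open>A discrete layer-cake bound, turning an expectation into a sum of tail
  probabilities.\<close>

lemma le_count_below:
  fixes y :: real
  shows "y \<le> real m \<Longrightarrow> y \<le> (\<Sum>k<m. indicator {real k<..} y)"
proof (induction m)
  case 0
  then show ?case by simp
next
  case (Suc m)
  show ?case
  proof (cases "y \<le> real m")
    case True
    then show ?thesis using Suc.IH by simp
  next
    case False
    then have "(\<Sum>k<Suc m. indicator {real k<..} y) = (\<Sum>k<Suc m. (1::real))"
      by (intro sum.cong) (auto simp: indicator_def)
    then show ?thesis using Suc.prems by simp
  qed
qed

text \<open>Depths are at least 1 at every outcome, not just almost surely, so the quenched bounds
  apply pointwise. The theorem reduces to this by changing the environment on a null set.\<close>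

locale pareto_traps = prob_space M for M :: "'w measure" +
  fixes T :: "'w \<Rightarrow> int \<Rightarrow> real" and \<alpha> :: real
  assumes \<alpha>_pos: "0 < \<alpha>"
    and indep: "indep_vars (\<lambda>_. borel) (\<lambda>x \<omega>. T \<omega> x) UNIV"
    and tail: "1 \<le> u \<Longrightarrow> prob {\<omega> \<in> space M. u < T \<omega> x} = u powr - \<alpha>"
    and T_ge_1: "1 \<le> T \<omega> x"
begin

sublocale traps: trap_landscape "T \<omega>" for \<omega>
  by standard (rule T_ge_1)

abbreviation vol :: "nat \<Rightarrow> 'w \<Rightarrow> real" where
  "vol r \<omega> \<equiv> traps.volume \<omega> r"

text \<open>The mean of \<open>dyadic_count n\<close>. It grows geometrically for \<alpha> < 1,
  equals \<open>n + 1\<close> for \<alpha> = 1 and stays bounded for \<alpha> > 1: the source of the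
  three regimes.\<close>

definition trunc_mean :: "nat \<Rightarrow> real" where
  "trunc_mean n = (\<Sum>k\<le>n. (2 powr (1 - \<alpha>)) ^ k)"

lemma measurable_T [measurable]: "(\<lambda>\<omega>. T \<omega> x) \<in> borel_measurable M"
  using indep unfolding indep_vars_def by auto

lemma measurable_vol [measurable]: "vol r \<in> borel_measurable M"
  unfolding traps.volume_def by measurable

lemma measurable_heat [measurable]: "(\<lambda>\<omega>. bt_heat_kernel (T \<omega>) t x y) \<in> borel_measurable M"
  by (rule measurable_bt_heat_kernel) measurable

lemma T_le_vol: "\<bar>x\<bar> \<le> int r \<Longrightarrow> T \<omega> x \<le> vol r \<omega>"
  unfolding traps.volume_def
  by (rule member_le_sum) (auto intro: less_imp_le[OF traps.trap_pos])

lemma integrable_bounded_01: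
  fixes f :: "'w \<Rightarrow> real"
  assumes [measurable]: "f \<in> borel_measurable M" and "\<And>\<omega>. 0 \<le> f \<omega>" "\<And>\<omega>. f \<omega> \<le> 1"
  shows "integrable M f"
  by (rule integrable_const_bound[where B = 1]) (use assms in auto)

lemma expectation_prod:
  fixes g :: "real \<Rightarrow> real"
  assumes [measurable]: "g \<in> borel_measurable borel" and g: "\<And>u. 0 \<le> g u" "\<And>u. g u \<le> 1" and "finite B"
  shows "expectation (\<lambda>\<omega>. \<Prod>x\<in>B. g (T \<omega> x)) = (\<Prod>x\<in>B. expectation (\<lambda>\<omega>. g (T \<omega> x)))"
proof (rule indep_vars_lebesgue_integral[OF \<open>finite B\<close>])
  show "indep_vars (\<lambda>_. borel) (\<lambda>x \<omega>. g (T \<omega> x)) B"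
    by (rule indep_vars_compose2[OF indep_vars_subset[OF indep]]) auto
  show "integrable M (\<lambda>\<omega>. g (T \<omega> x))" for x
    by (rule integrable_bounded_01) (use g in auto)
qed

lemma expectation_indicator_T:
  assumes "1 \<le> u" shows "expectation (\<lambda>\<omega>. indicator {u<..} (T \<omega> x)) = u powr - \<alpha>"
proof -
  have "expectation (\<lambda>\<omega>. indicator {u<..} (T \<omega> x)) = expectation (indicator {\<omega> \<in> space M. u < T \<omega> x})"
    by (intro Bochner_Integration.integral_cong) (auto simp: indicator_def)
  also have "\<dots> = u powr - \<alpha>" using tail[OF assms, of x] by simp
  finally show ?thesis .
qed

lemma integrable_indicator_T: "integrable M (\<lambda>\<omega>. indicator {u<..} (T \<omega> x) :: real)"
  by (rule integrable_bounded_01) (auto simp: indicator_def)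

lemma integrable_dyadic_count: "integrable M (\<lambda>\<omega>. dyadic_count n (T \<omega> x))"
  unfolding dyadic_count_def
  by (intro Bochner_Integration.integrable_sum integrable_mult_right integrable_indicator_T)

lemma expectation_dyadic_count: "expectation (\<lambda>\<omega>. dyadic_count n (T \<omega> x)) = trunc_mean n"
proof -
  have "2 ^ k * (2 ^ k) powr - \<alpha> = (2 powr (1 - \<alpha>)) ^ k" for k :: nat
    by (simp add: powr_realpow[symmetric] powr_powr powr_add[symmetric] algebra_simps)
  then show ?thesis
    unfolding dyadic_count_def trunc_mean_def
    by (subst Bochner_Integration.integral_sum)
       (auto intro!: integrable_mult_right integrable_indicator_T sum.cong
         simp: expectation_indicator_T simp del: integrable_mult_right_iff)
qed

section \<open>Tails and negative moments of the volume\<close>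

lemma prob_vol_large:
  assumes "0 < s"
  shows "prob {\<omega> \<in> space M. s < vol R \<omega>} \<le> (2 * real R + 1) * ((2 ^ Suc n) powr - \<alpha> + (1 + trunc_mean n) / s)"
proof -
  let ?B = "{-int R..int R}"
  \<comment> \<open>One function for a union bound and a Markov bound: the first term detects a trap
    deeper than \<open>2 ^ Suc n\<close>, the second dominates the volume over \<open>s\<close> when
    there is none.\<close>
  let ?g = "\<lambda>\<omega> x. indicator {2 ^ Suc n<..} (T \<omega> x) + (1 + dyadic_count n (T \<omega> x)) / s"
  have int: "integrable M (\<lambda>\<omega>. ?g \<omega> x)" for x
    by (intro Bochner_Integration.integrable_add integrable_divide integrable_indicator_T integrable_dyadic_count) simp
  have pw: "indicator {\<omega> \<in> space M. s < vol R \<omega>} \<omega> \<le> (\<Sum>x\<in>?B. ?g \<omega> x)" for \<omega>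
  proof -
    have nn: "0 \<le> ?g \<omega> x" for x
      using assms dyadic_count_nonneg[of n "T \<omega> x"] by (intro add_nonneg_nonneg divide_nonneg_pos) auto
    show ?thesis
    proof (cases "s < vol R \<omega>")
      case False
      then show ?thesis using nn by (simp add: sum_nonneg)
    next
      case True
      have "1 \<le> (\<Sum>x\<in>?B. ?g \<omega> x)"
      proof (cases "\<exists>x\<in>?B. 2 ^ Suc n < T \<omega> x")
        case True
        then obtain x where x: "x \<in> ?B" "2 ^ Suc n < T \<omega> x" by blast
        have "1 \<le> ?g \<omega> x" using x(2) assms dyadic_count_nonneg[of n "T \<omega> x"] by simp
        also have "\<dots> \<le> (\<Sum>x\<in>?B. ?g \<omega> x)"
          using x(1) nn by (intro member_le_sum) auto
        finally show ?thesis .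
      next
        case False
        have "1 \<le> vol R \<omega> / s" using \<open>s < vol R \<omega>\<close> assms by simp
        also have "\<dots> = (\<Sum>x\<in>?B. T \<omega> x / s)" by (simp add: traps.volume_def sum_divide_distrib)
        also have "\<dots> \<le> (\<Sum>x\<in>?B. ?g \<omega> x)"
        proof (rule sum_mono)
          fix x assume "x \<in> ?B"
          then have "T \<omega> x \<le> 2 ^ Suc n" using False by force
          then have "T \<omega> x / s \<le> (1 + dyadic_count n (T \<omega> x)) / s"
            using dyadic_count_ge[OF T_ge_1, of \<omega> x n] assms by (intro divide_right_mono) auto
          then show "T \<omega> x / s \<le> ?g \<omega> x" by (simp add: indicator_def)
        qed
        finally show ?thesis .
      qed
      then show ?thesis by (rule order_trans[rotated]) (simp add: indicator_def)
    qed
  qed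
  have "prob {\<omega> \<in> space M. s < vol R \<omega>} = expectation (indicator {\<omega> \<in> space M. s < vol R \<omega>})"
    by simp
  also have "\<dots> \<le> expectation (\<lambda>\<omega>. \<Sum>x\<in>?B. ?g \<omega> x)"
    by (intro integral_mono Bochner_Integration.integrable_sum int pw)
       (auto intro!: integrable_bounded_01 simp: indicator_def)
  also have "\<dots> = (\<Sum>x\<in>?B. (2 ^ Suc n) powr - \<alpha> + (1 + trunc_mean n) / s)"
  proof (subst Bochner_Integration.integral_sum[OF int], intro sum.cong refl)
    fix x
    have "expectation (\<lambda>\<omega>. 1 + dyadic_count n (T \<omega> x)) = 1 + trunc_mean n"
      by (subst Bochner_Integration.integral_add) (auto simp: integrable_dyadic_count expectation_dyadic_count prob_space)
    then show "expectation (\<lambda>\<omega>. ?g \<omega> x) = (2 ^ Suc n) powr - \<alpha> + (1 + trunc_mean n) / s"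
      by (subst Bochner_Integration.integral_add)
         (auto simp: integrable_indicator_T integrable_dyadic_count expectation_indicator_T simp del: power_Suc)
  qed
  also have "\<dots> = (2 * real R + 1) * ((2 ^ Suc n) powr - \<alpha> + (1 + trunc_mean n) / s)"
    by (simp del: power_Suc)
  finally show ?thesis .
qed

lemma vol_powr_le_1: "0 \<le> \<epsilon> \<Longrightarrow> vol m \<omega> powr - \<epsilon> \<le> 1"
  using traps.volume_ge[of m \<omega>] by (simp add: powr_minus_divide ge_one_powr_ge_zero)

lemma integrable_vol_powr: "0 \<le> \<epsilon> \<Longrightarrow> integrable M (\<lambda>\<omega>. vol m \<omega> powr - \<epsilon>)"
  by (rule integrable_bounded_01) (auto intro: vol_powr_le_1)

text \<open>The volume exceeds each single depth, so the event forces all \<open>2 m + 1\<close>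
  depths below the level \<open>u\<close> of tail probability \<open>k / m\<close>. By independence
  this has probability \<open>(1 - k / m) ^ (2 m + 1)\<close>, at most
  \<open>exp (- k)\<close>.\<close>

lemma prob_vol_powr_large:
  assumes "1 \<le> m" "k \<le> m"
  shows "prob {\<omega> \<in> space M. real k < real m * vol m \<omega> powr - \<alpha>} \<le> (1 / 2) ^ k"
proof (cases "k = 0")
  case True
  then show ?thesis by simp
next
  case False
  let ?B = "{-int m..int m}"
  define u where "u = (real m / real k) powr (1 / \<alpha>)"
  have ratio: "1 \<le> real m / real k" using False assms by simp
  then have u: "1 \<le> u" unfolding u_def using \<alpha>_pos by (intro ge_one_powr_ge_zero) auto
  have u_tail: "u powr - \<alpha> = real k / real m"
    unfolding u_def using \<alpha>_pos ratio by (simp add: powr_powr powr_minus_divide)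
  have small: "T \<omega> x \<le> u" if "real k < real m * vol m \<omega> powr - \<alpha>" "x \<in> ?B" for \<omega> x
  proof (rule ccontr)
    assume "\<not> T \<omega> x \<le> u"
    moreover have "T \<omega> x \<le> vol m \<omega>" using that(2) by (intro T_le_vol) auto
    ultimately have "u < vol m \<omega>" by linarith
    then have "vol m \<omega> powr - \<alpha> \<le> u powr - \<alpha>"
      using u \<alpha>_pos by (intro powr_mono2') auto
    then show False using that(1) assms unfolding u_tail by (simp add: field_simps)
  qed
  have E1: "expectation (\<lambda>\<omega>. indicator {..u} (T \<omega> x)) = 1 - real k / real m" for x
  proof -
    have "expectation (\<lambda>\<omega>. indicator {..u} (T \<omega> x)) = expectation (\<lambda>\<omega>. 1 - indicator {u<..} (T \<omega> x))"
      by (intro Bochner_Integration.integral_cong) (auto simp: indicator_def)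
    also have "\<dots> = 1 - real k / real m"
      by (subst Bochner_Integration.integral_diff)
         (auto simp: integrable_indicator_T expectation_indicator_T[OF u] u_tail prob_space)
    finally show ?thesis .
  qed
  have "prob {\<omega> \<in> space M. real k < real m * vol m \<omega> powr - \<alpha>}
      = expectation (indicator {\<omega> \<in> space M. real k < real m * vol m \<omega> powr - \<alpha>})"
    by simp
  also have "\<dots> \<le> expectation (\<lambda>\<omega>. \<Prod>x\<in>?B. indicator {..u} (T \<omega> x))"
  proof (rule integral_mono)
    show "integrable M (indicator {\<omega> \<in> space M. real k < real m * vol m \<omega> powr - \<alpha>} :: 'w \<Rightarrow> real)"
      by (intro integrable_bounded_01) (auto simp: indicator_def)
    show "integrable M (\<lambda>\<omega>. \<Prod>x\<in>?B. indicator {..u} (T \<omega> x) :: real)"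
      by (intro integrable_bounded_01 prod_nonneg prod_le_1) auto
    show "indicator {\<omega> \<in> space M. real k < real m * vol m \<omega> powr - \<alpha>} \<omega> \<le> (\<Prod>x\<in>?B. indicator {..u} (T \<omega> x) :: real)" for \<omega>
    proof (cases "real k < real m * vol m \<omega> powr - \<alpha>")
      case True
      then have "(\<Prod>x\<in>?B. indicator {..u} (T \<omega> x) :: real) = 1"
        using small by (intro prod.neutral) auto
      then show ?thesis by (simp add: indicator_def)
    qed (auto intro: prod_nonneg)
  qed
  also have "\<dots> = (1 - real k / real m) ^ (2 * m + 1)"
  proof -
    have "card ?B = 2 * m + 1" by simp
    then show ?thesis by (subst expectation_prod) (simp_all only: E1 prod_constant, auto)
  qed
  also have "\<dots> \<le> exp (- (real k / real m)) ^ (2 * m + 1)"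
    using exp_ge_add_one_self[of "- (real k / real m)"] assms by (intro power_mono) auto
  also have "\<dots> \<le> exp (- (real k / real m)) ^ m"
    by (intro power_decreasing) auto
  also have "\<dots> = exp (- 1) ^ k"
    using assms by (simp add: exp_of_nat_mult[symmetric])
  also have "\<dots> \<le> (1 / 2) ^ k"
    using exp_ge_add_one_self[of 1] by (intro power_mono) (auto simp: exp_minus field_simps)
  finally show ?thesis .
qed

text \<open>Since \<open>m * vol m \<omega> powr - \<alpha>\<close> is at most \<open>m\<close>, it
  is bounded by counting the levels \<open>k < m\<close> below it, and the tail bounds form a
  geometric series.\<close>

lemma expectation_vol_powr:
  assumes "1 \<le> m"
  shows "expectation (\<lambda>\<omega>. vol m \<omega> powr - \<alpha>) \<le> 2 / real m"
proof -
  let ?A = "\<lambda>k. {\<omega> \<in> space M. real k < real m * vol m \<omega> powr - \<alpha>}"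
  have "real m * expectation (\<lambda>\<omega>. vol m \<omega> powr - \<alpha>) = expectation (\<lambda>\<omega>. real m * vol m \<omega> powr - \<alpha>)"
    by simp
  also have "\<dots> \<le> expectation (\<lambda>\<omega>. \<Sum>k<m. indicator (?A k) \<omega>)"
  proof (rule integral_mono)
    fix \<omega> assume "\<omega> \<in> space M"
    have "real m * vol m \<omega> powr - \<alpha> \<le> (\<Sum>k<m. indicator {real k<..} (real m * vol m \<omega> powr - \<alpha>))"
      using mult_left_mono[OF vol_powr_le_1[where \<epsilon> = \<alpha> and m = m and \<omega> = \<omega>], of "real m"] \<alpha>_pos by (intro le_count_below) auto
    also have "\<dots> = (\<Sum>k<m. indicator (?A k) \<omega>)"
      using \<open>\<omega> \<in> space M\<close> by (intro sum.cong) (auto simp: indicator_def)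
    finally show "real m * vol m \<omega> powr - \<alpha> \<le> (\<Sum>k<m. indicator (?A k) \<omega>)" .
  next
    show "integrable M (\<lambda>\<omega>. real m * vol m \<omega> powr - \<alpha>)"
      using \<alpha>_pos by (intro integrable_mult_right integrable_vol_powr) simp
    show "integrable M (\<lambda>\<omega>. \<Sum>k<m. indicator (?A k) \<omega> :: real)"
      by (intro Bochner_Integration.integrable_sum integrable_bounded_01) (auto simp: indicator_def)
  qed
  also have "\<dots> = (\<Sum>k<m. prob (?A k))"
    by (subst Bochner_Integration.integral_sum) (auto intro!: integrable_bounded_01 simp: indicator_def)
  also have "\<dots> \<le> (\<Sum>k<m. (1 / 2) ^ k)"
    using assms by (intro sum_mono prob_vol_powr_large) auto
  also have "\<dots> \<le> 2"
    by (simp add: sum_gp_strict)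
  finally show ?thesis using assms by (simp add: field_simps)
qed

text \<open>At \<alpha> = 1 the deepest trap alone has order \<open>m\<close> and would miss the
  logarithm, here \<open>n + 1\<close>. A Chernoff bound with the Laplace transform at scale
  \<open>1 / 2 ^ n\<close> captures it.\<close>

lemma expectation_inverse_vol:
  assumes "\<alpha> = 1" "2 ^ n \<le> m" "m < 2 ^ Suc n"
  shows "expectation (\<lambda>\<omega>. vol m \<omega> powr - 1) \<le> 12 / (real m * real (n + 1))"
proof -
  let ?B = "{-int m..int m}"
  define l :: real where "l = 1 / 2 ^ n"
  \<comment> \<open>Chosen so that \<open>l * s = (n + 1) / 4\<close>: the factor
    \<open>exp (l * s)\<close> then consumes only half of the Laplace exponent
    \<open>(n + 1) / 2\<close>.\<close>
  define s :: real where "s = 2 ^ n * real (n + 1) / 4"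
  have m: "1 \<le> m" using assms(2) by (meson one_le_numeral one_le_power order_trans)
  have tm: "trunc_mean n = real (n + 1)" unfolding trunc_mean_def using assms(1) by simp
  \<comment> \<open>The absolute value only makes the test function bounded on the whole real line.\<close>
  have lap: "expectation (\<lambda>\<omega>. exp (- l * \<bar>T \<omega> x\<bar>)) \<le> exp (- (l * real (n + 1) / 4))" for x
  proof -
    have "expectation (\<lambda>\<omega>. exp (- l * \<bar>T \<omega> x\<bar>)) \<le> expectation (\<lambda>\<omega>. 1 - l / 4 * dyadic_count n (T \<omega> x))"
    proof (rule integral_mono)
      fix \<omega>
      have "exp (- (l * T \<omega> x)) \<le> 1 - min (l * T \<omega> x) 1 / 2"
        using traps.trap_pos[of \<omega> x] by (intro exp_minus_le_min) (simp add: l_def)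
      also have "min (l * T \<omega> x) 1 = l * min (T \<omega> x) (2 ^ n)"
        by (auto simp: l_def min_def field_simps)
      also have "1 - l * min (T \<omega> x) (2 ^ n) / 2 \<le> 1 - l / 4 * dyadic_count n (T \<omega> x)"
        using mult_left_mono[OF dyadic_count_le[OF T_ge_1, of n \<omega> x], of "l / 4"] by (simp add: l_def)
      finally show "exp (- l * \<bar>T \<omega> x\<bar>) \<le> 1 - l / 4 * dyadic_count n (T \<omega> x)"
        using traps.trap_pos[of \<omega> x] by simp
    next
      show "integrable M (\<lambda>\<omega>. exp (- l * \<bar>T \<omega> x\<bar>))"
        by (intro integrable_bounded_01) (auto simp: l_def)
      show "integrable M (\<lambda>\<omega>. 1 - l / 4 * dyadic_count n (T \<omega> x))"
        by (intro Bochner_Integration.integrable_diff integrable_mult_right integrable_dyadic_count) simp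
    qed
    also have "\<dots> = 1 - l * real (n + 1) / 4"
      by (subst Bochner_Integration.integral_diff)
         (auto simp: integrable_dyadic_count expectation_dyadic_count tm prob_space)
    also have "\<dots> \<le> exp (- (l * real (n + 1) / 4))"
      using exp_ge_add_one_self[of "- (l * real (n + 1) / 4)"] by simp
    finally show ?thesis .
  qed
  have "expectation (\<lambda>\<omega>. \<Prod>x\<in>?B. exp (- l * \<bar>T \<omega> x\<bar>)) = (\<Prod>x\<in>?B. expectation (\<lambda>\<omega>. exp (- l * \<bar>T \<omega> x\<bar>)))"
    by (rule expectation_prod[where g = "\<lambda>u. exp (- l * \<bar>u\<bar>)"]) (auto simp: l_def)
  also have "\<dots> \<le> (\<Prod>x\<in>?B. exp (- (l * real (n + 1) / 4)))"
    by (intro prod_mono conjI lap) simp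
  also have "\<dots> = exp (- (real (2 * m + 1) * l * real (n + 1) / 4))"
  proof -
    have "card ?B = 2 * m + 1" by simp
    then show ?thesis
      unfolding prod_constant exp_of_nat_mult[symmetric]
      by (simp only:, intro arg_cong[where f = exp]) (simp add: field_simps)
  qed
  also have "\<dots> \<le> exp (- (real (n + 1) / 2))"
  proof -
    have "1 \<le> real m * l" "0 < l" using assms(2) by (simp_all add: l_def divide_simps)
    moreover have "real (2 * m + 1) * l = 2 * (real m * l) + l" by (simp add: algebra_simps)
    ultimately have "2 \<le> real (2 * m + 1) * l" by linarith
    then have "2 * real (n + 1) \<le> real (2 * m + 1) * l * real (n + 1)"
      by (intro mult_right_mono) auto
    then show ?thesis by simp
  qed
  finally have laplace: "expectation (\<lambda>\<omega>. \<Prod>x\<in>?B. exp (- l * \<bar>T \<omega> x\<bar>)) \<le> exp (- (real (n + 1) / 2))" .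
  \<comment> \<open>Above \<open>s\<close> the inverse volume is at most \<open>1 / s\<close>. Below
    \<open>s\<close> it is at most \<open>1 / m\<close>, and \<open>exp (l * (s - V))\<close>
    dominates the indicator of that event.\<close>
  have pw: "vol m \<omega> powr - 1 \<le> 1 / s + exp (l * s) / real m * (\<Prod>x\<in>?B. exp (- l * \<bar>T \<omega> x\<bar>))" for \<omega>
  proof -
    have prod: "(\<Prod>x\<in>?B. exp (- l * \<bar>T \<omega> x\<bar>)) = exp (- l * vol m \<omega>)"
      using traps.trap_pos[of \<omega>]
      by (simp add: traps.volume_def exp_sum[symmetric] sum_distrib_left sum_negf less_imp_le)
    have s: "0 < s" by (simp add: s_def)
    have inv: "vol m \<omega> powr - 1 = 1 / vol m \<omega>"
      using traps.volume_pos[of \<omega> m] by (simp add: powr_minus_divide)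
    show ?thesis
    proof (cases "s \<le> vol m \<omega>")
      case True
      then have "1 / vol m \<omega> \<le> 1 / s" using s by (intro divide_left_mono) auto
      moreover have "0 \<le> exp (l * s) / real m * exp (- l * vol m \<omega>)" by simp
      ultimately show ?thesis unfolding prod inv by linarith
    next
      case False
      have "1 / vol m \<omega> \<le> 1 / real m"
        using traps.volume_ge[of m \<omega>] m by (intro divide_left_mono) auto
      also have "\<dots> \<le> 1 / real m * exp (l * (s - vol m \<omega>))"
        using False mult_left_mono[of 1 "exp (l * (s - vol m \<omega>))" "1 / real m"] by (simp add: l_def)
      also have "\<dots> = exp (l * s) / real m * exp (- l * vol m \<omega>)"
        by (simp add: exp_add[symmetric] right_diff_distrib)
      moreover have "0 \<le> 1 / s" using s by simp
      ultimately show ?thesis unfolding prod inv by linarith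
    qed
  qed
  have int: "integrable M (\<lambda>\<omega>. \<Prod>x\<in>?B. exp (- l * \<bar>T \<omega> x\<bar>))"
    by (intro integrable_bounded_01 prod_nonneg prod_le_1) (auto simp: l_def)
  have "expectation (\<lambda>\<omega>. vol m \<omega> powr - 1)
      \<le> expectation (\<lambda>\<omega>. 1 / s + exp (l * s) / real m * (\<Prod>x\<in>?B. exp (- l * \<bar>T \<omega> x\<bar>)))"
    by (intro integral_mono pw integrable_vol_powr Bochner_Integration.integrable_add integrable_mult_right int) auto
  also have "\<dots> = 1 / s + exp (l * s) / real m * expectation (\<lambda>\<omega>. \<Prod>x\<in>?B. exp (- l * \<bar>T \<omega> x\<bar>))"
    by (subst Bochner_Integration.integral_add) (auto simp: int[simplified] prob_space)
  also have "\<dots> \<le> 1 / s + exp (l * s) / real m * exp (- (real (n + 1) / 2))"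
    by (intro add_left_mono mult_left_mono laplace) auto
  also have "\<dots> = 1 / s + 1 / real m * exp (- (real (n + 1) / 4))"
  proof -
    have "l * s = real (n + 1) / 4" by (simp add: l_def s_def)
    then show ?thesis by (simp add: exp_add[symmetric] del: of_nat_Suc of_nat_add) (simp add: field_simps)
  qed
  also have "\<dots> \<le> 8 / (real m * real (n + 1)) + 4 / (real m * real (n + 1))"
  proof (rule add_mono)
    have "real m \<le> 2 * 2 ^ n" using assms(3) by (metis of_nat_le_iff of_nat_numeral of_nat_power order_less_imp_le power_Suc)
    then have "real m * real (n + 1) \<le> 2 * 2 ^ n * real (n + 1)" by (intro mult_right_mono) auto
    then show "1 / s \<le> 8 / (real m * real (n + 1))"
      using m by (simp add: s_def divide_simps del: of_nat_add of_nat_Suc)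
    have "real (n + 1) / 4 \<le> exp (real (n + 1) / 4)"
      using exp_ge_add_one_self[of "real (n + 1) / 4"] by linarith
    then have "exp (- (real (n + 1) / 4)) \<le> 4 / real (n + 1)"
      by (simp add: exp_minus divide_simps del: of_nat_add of_nat_Suc)
    then have "1 / real m * exp (- (real (n + 1) / 4)) \<le> 1 / real m * (4 / real (n + 1))"
      by (intro mult_left_mono) auto
    then show "1 / real m * exp (- (real (n + 1) / 4)) \<le> 4 / (real m * real (n + 1))" by simp
  qed
  finally show ?thesis by simp
qed

subsection \<open>Moments of the heat kernel\<close>

text \<open>Markov's inequality for the negative moment; the constant is chosen so that the level in
  the event becomes four times the bound on the expectation.\<close>

lemma prob_vol_small:
  assumes "0 < \<epsilon>" "0 < C" "0 < p" "expectation (\<lambda>\<omega>. vol m \<omega> powr - \<epsilon>) \<le> C * p powr \<epsilon>"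
  shows "prob {\<omega> \<in> space M. vol m \<omega> \<le> (4 * C) powr (- 1 / \<epsilon>) / p} \<le> 1 / 4"
proof -
  define c where "c = (4 * C) powr (- 1 / \<epsilon>)"
  have c: "0 < c" using assms by (simp add: c_def)
  have level: "(c / p) powr - \<epsilon> = 4 * C * p powr \<epsilon>"
  proof -
    have "(c / p) powr - \<epsilon> = c powr - \<epsilon> * p powr \<epsilon>"
      using c assms by (simp add: powr_divide powr_minus_divide)
    also have "c powr - \<epsilon> = 4 * C"
      using assms by (simp add: c_def powr_powr)
    finally show ?thesis .
  qed
  have "{\<omega> \<in> space M. vol m \<omega> \<le> c / p} \<subseteq> {\<omega> \<in> space M. 4 * C * p powr \<epsilon> \<le> vol m \<omega> powr - \<epsilon>}"
    unfolding level[symmetric] using traps.volume_pos assms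
    by (auto intro!: powr_mono2')
  then have "prob {\<omega> \<in> space M. vol m \<omega> \<le> c / p} \<le> prob {\<omega> \<in> space M. 4 * C * p powr \<epsilon> \<le> vol m \<omega> powr - \<epsilon>}"
    by (intro finite_measure_mono) auto
  also have "\<dots> \<le> expectation (\<lambda>\<omega>. vol m \<omega> powr - \<epsilon>) / (4 * C * p powr \<epsilon>)"
    using assms by (intro integral_Markov_inequality_measure[where A = "{}"] integrable_vol_powr) auto
  also have "\<dots> \<le> C * p powr \<epsilon> / (4 * C * p powr \<epsilon>)"
    using assms by (intro divide_right_mono) auto
  also have "\<dots> = 1 / 4" using assms by simp
  finally show ?thesis by (simp add: c_def)
qed

lemma integrable_heat_powr:
  assumes "0 \<le> t" "0 \<le> \<epsilon>"
  shows "integrable M (\<lambda>\<omega>. bt_heat_kernel (T \<omega>) t 0 0 powr \<epsilon>)"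
proof (rule integrable_bounded_01)
  show "bt_heat_kernel (T \<omega>) t 0 0 powr \<epsilon> \<le> 1" for \<omega>
    using powr_mono2[OF assms(2) traps.heat_kernel_nonneg[OF assms(1)] traps.heat_kernel_le_1[OF assms(1)]] by simp
qed auto

text \<open>With \<open>r = m \<le> 2 t p\<close> the second term of the quenched bound is at most
  \<open>32 p\<close>. Bounding the sum of the two terms by twice their maximum works for every
  exponent and gives the constants 4 and 64.\<close>

lemma moment_upper:
  assumes "0 < \<epsilon>" "0 < t" "0 < p" "1 \<le> m" "real m \<le> 2 * (t * p)"
    and E: "expectation (\<lambda>\<omega>. vol m \<omega> powr - \<epsilon>) \<le> C * p powr \<epsilon>"
  shows "expectation (\<lambda>\<omega>. bt_heat_kernel (T \<omega>) t 0 0 powr \<epsilon>) \<le> (4 powr \<epsilon> * C + 64 powr \<epsilon>) * p powr \<epsilon>"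
proof -
  have pw: "bt_heat_kernel (T \<omega>) t 0 0 powr \<epsilon> \<le> 4 powr \<epsilon> * vol m \<omega> powr - \<epsilon> + 64 powr \<epsilon> * p powr \<epsilon>" for \<omega>
  proof -
    let ?a = "2 / vol m \<omega>" and ?b = "32 * p"
    have pos: "0 < ?a" "0 < ?b" using traps.volume_pos assms by auto
    have "16 * real m / t \<le> ?b" using assms by (simp add: field_simps)
    then have "bt_heat_kernel (T \<omega>) t 0 0 \<le> ?a + ?b"
      using traps.heat_kernel_upper[OF assms(2,4), of \<omega>] by linarith
    also have "\<dots> \<le> 2 * max ?a ?b" by simp
    finally have "bt_heat_kernel (T \<omega>) t 0 0 powr \<epsilon> \<le> (2 * max ?a ?b) powr \<epsilon>"
      using assms traps.heat_kernel_nonneg[of t \<omega>] by (intro powr_mono2) auto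
    also have "\<dots> \<le> (2 * ?a) powr \<epsilon> + (2 * ?b) powr \<epsilon>"
      by (simp add: max_def)
    also have "(2 * ?a) powr \<epsilon> = 4 powr \<epsilon> * vol m \<omega> powr - \<epsilon>"
      using traps.volume_pos[of \<omega> m] by (simp add: powr_divide powr_minus_divide)
    also have "(2 * ?b) powr \<epsilon> = 64 powr \<epsilon> * p powr \<epsilon>"
      using assms by (simp add: powr_mult[symmetric])
    finally show ?thesis .
  qed
  have "expectation (\<lambda>\<omega>. bt_heat_kernel (T \<omega>) t 0 0 powr \<epsilon>)
      \<le> expectation (\<lambda>\<omega>. 4 powr \<epsilon> * vol m \<omega> powr - \<epsilon> + 64 powr \<epsilon> * p powr \<epsilon>)"
    using assms by (intro integral_mono pw integrable_heat_powr Bochner_Integration.integrable_add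
        integrable_mult_right integrable_vol_powr) auto
  also have "\<dots> = 4 powr \<epsilon> * expectation (\<lambda>\<omega>. vol m \<omega> powr - \<epsilon>) + 64 powr \<epsilon> * p powr \<epsilon>"
    using assms by (subst Bochner_Integration.integral_add)
      (auto intro!: integrable_mult_right integrable_vol_powr simp: prob_space simp del: integrable_mult_right_iff)
  also have "\<dots> \<le> 4 powr \<epsilon> * (C * p powr \<epsilon>) + 64 powr \<epsilon> * p powr \<epsilon>"
    by (intro add_right_mono mult_left_mono E) auto
  finally show ?thesis by (simp add: algebra_simps)
qed

text \<open>With probability at least 1/2 both exceptional events fail. Then \<open>m V\<close> is
  at least \<open>t c\<close>, so the exponential factor is at least
  \<open>exp (- 1 / (2 c))\<close>, while the volume in the denominator is at most
  \<open>C / p\<close>.\<close>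

lemma moment_lower:
  assumes "0 < \<epsilon>" "0 < t" "0 < p" "1 \<le> m" "t * p \<le> real m" "0 < c" "0 < C"
    and small: "prob {\<omega> \<in> space M. vol m \<omega> \<le> c / p} \<le> 1 / 4"
    and large: "prob {\<omega> \<in> space M. C / p < vol (5 * m) \<omega>} \<le> 1 / 4"
  shows "(exp (- 1 / (2 * c)) / (8 * C)) powr \<epsilon> / 2 * p powr \<epsilon>
    \<le> expectation (\<lambda>\<omega>. bt_heat_kernel (T \<omega>) t 0 0 powr \<epsilon>)"
proof -
  define k where "k = exp (- 1 / (2 * c)) / (8 * C)"
  let ?A = "{\<omega> \<in> space M. vol m \<omega> \<le> c / p}" and ?B = "{\<omega> \<in> space M. C / p < vol (5 * m) \<omega>}"
  have k: "0 < k" using assms by (simp add: k_def)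
  \<comment> \<open>The factor \<open>1 - 1_A - 1_B\<close> is a lower bound for the indicator of
    the good event and integrates directly to the two given probabilities.\<close>
  have pw: "(k * p) powr \<epsilon> * (1 - indicator ?A \<omega> - indicator ?B \<omega>) \<le> bt_heat_kernel (T \<omega>) t 0 0 powr \<epsilon>"
    if \<omega>: "\<omega> \<in> space M" for \<omega>
  proof (cases "\<omega> \<in> ?A \<or> \<omega> \<in> ?B")
    case True
    then have "1 - indicator ?A \<omega> - indicator ?B \<omega> \<le> (0::real)" by (auto simp: indicator_def)
    then have "(k * p) powr \<epsilon> * (1 - indicator ?A \<omega> - indicator ?B \<omega>) \<le> 0"
      by (intro mult_nonneg_nonpos) auto
    also have "0 \<le> bt_heat_kernel (T \<omega>) t 0 0 powr \<epsilon>" by simp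
    finally show ?thesis .
  next
    case False
    then have v: "c / p < vol m \<omega>" "vol (5 * m) \<omega> \<le> C / p" using \<omega> by auto
    have "t * c = t * p * (c / p)" using assms by simp
    also have "\<dots> \<le> real m * vol m \<omega>" using v assms by (intro mult_mono) auto
    finally have "t \<le> real m * vol m \<omega> / c"
      using assms by (simp add: pos_le_divide_eq)
    then have "t / (2 * real m * vol m \<omega>) \<le> real m * vol m \<omega> / c / (2 * real m * vol m \<omega>)"
      using traps.volume_pos[of \<omega> m] by (intro divide_right_mono) auto
    also have "\<dots> = 1 / (2 * c)"
      using assms traps.volume_pos[of \<omega> m] by simp
    finally have "t / (2 * real m * vol m \<omega>) \<le> 1 / (2 * c)" .
    then have e: "exp (- 1 / (2 * c)) \<le> exp (- t / (2 * real m * vol m \<omega>))" by simp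
    have "k * p = exp (- 1 / (2 * c)) / (8 * (C / p))" using assms by (simp add: k_def)
    also have "\<dots> \<le> exp (- t / (2 * real m * vol m \<omega>)) / (8 * vol (5 * m) \<omega>)"
      using e v traps.volume_pos by (intro frac_le) auto
    also have "\<dots> \<le> bt_heat_kernel (T \<omega>) t 0 0"
      by (rule traps.heat_kernel_lower[OF assms(2,4)])
    finally have "(k * p) powr \<epsilon> \<le> bt_heat_kernel (T \<omega>) t 0 0 powr \<epsilon>"
      using k assms by (intro powr_mono2) auto
    then show ?thesis using False by simp
  qed
  have ind: "integrable M (indicator A :: 'w \<Rightarrow> real)" if "A \<in> events" for A
    by (rule integrable_bounded_01) (use that in \<open>auto simp: indicator_def\<close>)
  have AB: "?A \<in> events" "?B \<in> events" by measurable
  have "k powr \<epsilon> / 2 * p powr \<epsilon> = (k * p) powr \<epsilon> * (1 / 2)"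
    by (simp add: powr_mult less_imp_le[OF k] less_imp_le[OF assms(3)])
  also have "\<dots> \<le> (k * p) powr \<epsilon> * (1 - prob ?A - prob ?B)"
  proof (rule mult_left_mono)
    show "1 / 2 \<le> 1 - prob ?A - prob ?B" using small large by linarith
  qed simp
  also have "\<dots> = expectation (\<lambda>\<omega>. (k * p) powr \<epsilon> * (1 - indicator ?A \<omega> - indicator ?B \<omega>))"
  proof -
    have "expectation (\<lambda>\<omega>. 1 - indicator ?A \<omega> - indicator ?B \<omega>) = 1 - prob ?A - prob ?B"
      using AB
      by (subst Bochner_Integration.integral_diff
          | intro Bochner_Integration.integrable_diff ind AB integrable_const
          | simp add: prob_space)+
    then show ?thesis by simp
  qed
  also have "\<dots> \<le> expectation (\<lambda>\<omega>. bt_heat_kernel (T \<omega>) t 0 0 powr \<epsilon>)"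
    using assms(1,2)
    by (intro integral_mono pw integrable_heat_powr integrable_mult_right Bochner_Integration.integrable_diff
        ind AB integrable_const) simp_all
  finally show ?thesis by (simp add: k_def)
qed

definition moment_comparable :: "real \<Rightarrow> bool" where
  "moment_comparable \<epsilon> \<longleftrightarrow>
    0 < Liminf at_top (\<lambda>t. ereal (phi_alpha \<alpha> t powr (- \<epsilon>) *
        (\<integral>\<omega>. bt_heat_kernel (T \<omega>) t 0 0 powr \<epsilon> \<partial>M))) \<and>
    Limsup at_top (\<lambda>t. ereal (phi_alpha \<alpha> t powr (- \<epsilon>) *
        (\<integral>\<omega>. bt_heat_kernel (T \<omega>) t 0 0 powr \<epsilon> \<partial>M))) < \<infinity>"

text \<open>The ball of radius \<open>5 m\<close> has at most \<open>11 m\<close>, hence at most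
  \<open>22 y\<close>, sites. The deep traps and the truncated sum each contribute 1/8.\<close>

lemma prob_vol_ball_large:
  assumes "1 \<le> m" "real m \<le> 2 * y" "0 < s"
    and "22 * y * (2 ^ Suc n) powr - \<alpha> \<le> 1 / 8" "22 * y * (1 + trunc_mean n) \<le> s / 8"
  shows "prob {\<omega> \<in> space M. s < vol (5 * m) \<omega>} \<le> 1 / 4"
proof -
  have tm: "0 \<le> trunc_mean n" unfolding trunc_mean_def by (intro sum_nonneg) simp
  have "prob {\<omega> \<in> space M. s < vol (5 * m) \<omega>}
      \<le> (2 * real (5 * m) + 1) * ((2 ^ Suc n) powr - \<alpha> + (1 + trunc_mean n) / s)"
    by (rule prob_vol_large[OF assms(3)])
  also have "\<dots> \<le> (22 * y) * ((2 ^ Suc n) powr - \<alpha> + (1 + trunc_mean n) / s)"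
    using assms tm by (intro mult_right_mono add_nonneg_nonneg divide_nonneg_pos) auto
  also have "\<dots> = 22 * y * (2 ^ Suc n) powr - \<alpha> + 22 * y * (1 + trunc_mean n) / s"
    by (simp add: algebra_simps add_divide_distrib)
  also have "\<dots> \<le> 1 / 8 + (s / 8) / s"
    using assms by (intro add_mono divide_right_mono) auto
  finally show ?thesis using assms by simp
qed

text \<open>Separates the probability from the asymptotics of \<open>phi_alpha\<close>: with radius
  \<open>t * phi\<close> and volume scale \<open>1 / phi\<close>, each regime only has to supply a
  negative moment and a truncation level.\<close>

lemma moment_comparableI:
  assumes \<epsilon>: "0 < \<epsilon>" and C: "0 < C\<^sub>1" "0 < C\<^sub>2"
    and scale: "\<forall>\<^sub>F t in at_top. 0 < phi_alpha \<alpha> t \<and> 1 \<le> t * phi_alpha \<alpha> t"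
    and inv: "\<forall>\<^sub>F t in at_top. \<forall>m. t * phi_alpha \<alpha> t \<le> real m \<longrightarrow> real m \<le> 2 * (t * phi_alpha \<alpha> t) \<longrightarrow>
      expectation (\<lambda>\<omega>. vol m \<omega> powr - \<epsilon>) \<le> C\<^sub>1 * phi_alpha \<alpha> t powr \<epsilon>"
    and trunc: "\<forall>\<^sub>F t in at_top. \<exists>n. 22 * (t * phi_alpha \<alpha> t) * (2 ^ Suc n) powr - \<alpha> \<le> 1 / 8 \<and>
      22 * (t * phi_alpha \<alpha> t) * (1 + trunc_mean n) \<le> C\<^sub>2 / phi_alpha \<alpha> t / 8"
  shows "moment_comparable \<epsilon>"
proof -
  define F where "F = (\<lambda>t. phi_alpha \<alpha> t powr - \<epsilon> * expectation (\<lambda>\<omega>. bt_heat_kernel (T \<omega>) t 0 0 powr \<epsilon>))"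
  define c where "c = (4 * C\<^sub>1) powr (- 1 / \<epsilon>)"
  define K\<^sub>1 where "K\<^sub>1 = (exp (- 1 / (2 * c)) / (8 * C\<^sub>2)) powr \<epsilon> / 2"
  define K\<^sub>2 where "K\<^sub>2 = 4 powr \<epsilon> * C\<^sub>1 + 64 powr \<epsilon>"
  have c: "0 < c" and K1: "0 < K\<^sub>1" using C by (auto simp: c_def K\<^sub>1_def)
  have bounds: "\<forall>\<^sub>F t in at_top. K\<^sub>1 \<le> F t \<and> F t \<le> K\<^sub>2"
    using scale inv trunc eventually_gt_at_top[of 0]
  proof eventually_elim
    case (elim t)
    define p where "p = phi_alpha \<alpha> t"
    \<comment> \<open>Rounding up at most doubles the radius because \<open>t * p\<close> is at
      least 1; this is why \<open>inv\<close> ranges over a factor of two.\<close>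
    define m where "m = nat \<lceil>t * p\<rceil>"
    have p: "0 < p" "1 \<le> t * p" using elim by (auto simp: p_def)
    have "0 \<le> \<lceil>t * p\<rceil>" using p by linarith
    then have "real m = of_int \<lceil>t * p\<rceil>" by (simp add: m_def)
    then have m: "t * p \<le> real m" "real m \<le> 2 * (t * p)" using p by linarith+
    then have m1: "1 \<le> m" using p by linarith
    have E: "expectation (\<lambda>\<omega>. vol m \<omega> powr - \<epsilon>) \<le> C\<^sub>1 * p powr \<epsilon>"
      using elim m by (simp add: p_def)
    obtain n where n: "22 * (t * p) * (2 ^ Suc n) powr - \<alpha> \<le> 1 / 8"
        "22 * (t * p) * (1 + trunc_mean n) \<le> C\<^sub>2 / p / 8"
      using elim by (auto simp: p_def)
    have large: "prob {\<omega> \<in> space M. C\<^sub>2 / p < vol (5 * m) \<omega>} \<le> 1 / 4"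
      using m1 m n p C by (intro prob_vol_ball_large[where y = "t * p" and n = n]) auto
    have small: "prob {\<omega> \<in> space M. vol m \<omega> \<le> c / p} \<le> 1 / 4"
      unfolding c_def by (rule prob_vol_small[OF \<epsilon> C(1) p(1) E])
    have "K\<^sub>1 * p powr \<epsilon> \<le> expectation (\<lambda>\<omega>. bt_heat_kernel (T \<omega>) t 0 0 powr \<epsilon>)"
      unfolding K\<^sub>1_def using elim by (intro moment_lower[OF \<epsilon> _ p(1) m1 m(1) c C(2) small large]) auto
    moreover have "expectation (\<lambda>\<omega>. bt_heat_kernel (T \<omega>) t 0 0 powr \<epsilon>) \<le> K\<^sub>2 * p powr \<epsilon>"
      unfolding K\<^sub>2_def using elim by (intro moment_upper[OF \<epsilon> _ p(1) m1 m(2) E]) auto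
    ultimately have "p powr - \<epsilon> * (K\<^sub>1 * p powr \<epsilon>) \<le> F t" "F t \<le> p powr - \<epsilon> * (K\<^sub>2 * p powr \<epsilon>)"
      unfolding F_def p_def[symmetric] by (auto intro!: mult_left_mono)
    moreover have "p powr - \<epsilon> * (K * p powr \<epsilon>) = K" for K
      using p by (simp add: powr_minus field_simps)
    ultimately show ?case by simp
  qed
  have "ereal K\<^sub>1 \<le> Liminf at_top (\<lambda>t. ereal (F t))"
    by (rule Liminf_bounded) (use bounds in \<open>auto elim: eventually_mono\<close>)
  moreover have "Limsup at_top (\<lambda>t. ereal (F t)) \<le> ereal K\<^sub>2"
    by (rule Limsup_bounded) (use bounds in \<open>auto elim: eventually_mono\<close>)
  ultimately have "0 < Liminf at_top (\<lambda>t. ereal (F t))" "Limsup at_top (\<lambda>t. ereal (F t)) < \<infinity>"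
    using K1 by (auto intro: less_le_trans[of 0 "ereal K\<^sub>1"] le_less_trans[of _ "ereal K\<^sub>2"])
  then show ?thesis unfolding moment_comparable_def F_def by blast
qed

section \<open>The regimes \<alpha> < 1, \<alpha> > 1 and \<alpha> = 1\<close>

lemma dyadic_scale:
  fixes y :: real
  assumes "1 \<le> y" obtains n :: nat where "2 ^ n \<le> y" "y < 2 ^ Suc n"
proof -
  have "1 \<le> nat \<lfloor>y\<rfloor>" using assms by linarith
  then obtain n where n: "2 ^ n \<le> nat \<lfloor>y\<rfloor>" "nat \<lfloor>y\<rfloor> < 2 ^ Suc n"
    using ex_power_ivl1[of 2 "nat \<lfloor>y\<rfloor>"] by auto
  have "real (2 ^ n) \<le> real (nat \<lfloor>y\<rfloor>)" using n(1) by (simp only: of_nat_le_iff)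
  also have "\<dots> \<le> y" using assms by (intro of_nat_floor) simp
  finally have lower: "2 ^ n \<le> y" by simp
  have "y < real (nat \<lfloor>y\<rfloor> + 1)" using assms by linarith
  also have "real (nat \<lfloor>y\<rfloor> + 1) \<le> real (2 ^ Suc n)"
    using n(2) by (simp only: of_nat_le_iff Suc_eq_plus1[symmetric] Suc_le_eq)
  finally have "y < 2 ^ Suc n" by simp
  with lower show ?thesis by (rule that)
qed

text \<open>With \<open>v = 1 / phi\<close> the radius is \<open>v powr \<alpha>\<close>, the number
  of sites among which the deepest trap has order \<open>v\<close>; such traps dominate the volume.
  The truncation level is a multiple of \<open>v\<close>.\<close>

lemma moment_comparable_lt_1:
  assumes "\<alpha> < 1" shows "moment_comparable \<alpha>"
proof -
  define q where "q = 2 powr (1 - \<alpha>)"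
  define K where "K = 1 + q / (q - 1)"
  \<comment> \<open>\<open>A\<close> solves \<open>22 * A powr - \<alpha> = 1 / 8\<close>, so that
    traps deeper than \<open>A v\<close> are unlikely in the ball; 176 is 22 times 8.\<close>
  define A where "A = 176 powr (1 / \<alpha>)"
  define C where "C = 176 * K * A powr (1 - \<alpha>)"
  have q: "1 < q" unfolding q_def using assms by simp
  then have K: "0 < K" by (simp add: K_def add_pos_pos)
  have A: "1 \<le> A" unfolding A_def using \<alpha>_pos by (intro ge_one_powr_ge_zero) auto
  then have C: "0 < C" using K by (simp add: C_def)
  have trunc: "1 + trunc_mean n \<le> K * (2 ^ n) powr (1 - \<alpha>)" for n
  proof -
    have qn: "q ^ n = (2 ^ n) powr (1 - \<alpha>)"
      by (simp add: q_def powr_realpow[symmetric] powr_powr mult.commute)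
    have "trunc_mean n = (q ^ Suc n - 1) / (q - 1)"
      unfolding trunc_mean_def q_def[symmetric] using q geometric_sum[of q "Suc n"] by (simp only: lessThan_Suc_atMost)
    also have "\<dots> \<le> q / (q - 1) * q ^ n"
      using q by (simp add: divide_simps)
    finally have "1 + trunc_mean n \<le> q ^ n + q / (q - 1) * q ^ n"
      using q one_le_power[of q n] by linarith
    then show ?thesis unfolding qn[symmetric] K_def by (simp add: algebra_simps)
  qed
  have phi: "phi_alpha \<alpha> t = t powr (- 1 / (1 + \<alpha>))" for t
    using assms by (simp add: phi_alpha_def)
  have tphi: "t * phi_alpha \<alpha> t = (1 / phi_alpha \<alpha> t) powr \<alpha>" "1 \<le> 1 / phi_alpha \<alpha> t" "0 < phi_alpha \<alpha> t"
    if "1 \<le> t" for t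
  proof -
    have e: "1 + - 1 / (1 + \<alpha>) = 1 / (1 + \<alpha>) * \<alpha>" using \<alpha>_pos by (simp add: field_simps)
    have v: "1 / phi_alpha \<alpha> t = t powr (1 / (1 + \<alpha>))"
      unfolding phi by (simp add: powr_minus_divide)
    have "t * phi_alpha \<alpha> t = t powr (1 + - 1 / (1 + \<alpha>))"
      unfolding phi powr_add using that by simp
    then show "t * phi_alpha \<alpha> t = (1 / phi_alpha \<alpha> t) powr \<alpha>"
      unfolding v powr_powr e .
    show "1 \<le> 1 / phi_alpha \<alpha> t"
      unfolding v using that \<alpha>_pos by (intro ge_one_powr_ge_zero) auto
    show "0 < phi_alpha \<alpha> t" unfolding phi using that by simp
  qed
  show ?thesis
  proof (rule moment_comparableI[where C\<^sub>1 = 2 and C\<^sub>2 = C])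
    show "\<forall>\<^sub>F t in at_top. 0 < phi_alpha \<alpha> t \<and> 1 \<le> t * phi_alpha \<alpha> t"
      using eventually_ge_at_top[of 1]
    proof eventually_elim
      case (elim t)
      then show ?case
        using tphi[of t] \<alpha>_pos ge_one_powr_ge_zero[of "1 / phi_alpha \<alpha> t" \<alpha>] by auto
    qed
    show "\<forall>\<^sub>F t in at_top. \<forall>m. t * phi_alpha \<alpha> t \<le> real m \<longrightarrow> real m \<le> 2 * (t * phi_alpha \<alpha> t) \<longrightarrow>
      expectation (\<lambda>\<omega>. vol m \<omega> powr - \<alpha>) \<le> 2 * phi_alpha \<alpha> t powr \<alpha>"
      using eventually_ge_at_top[of 1]
    proof (eventually_elim, intro allI impI)
      fix t :: real and m assume t: "1 \<le> t" and m: "t * phi_alpha \<alpha> t \<le> real m"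
      let ?p = "phi_alpha \<alpha> t"
      have pos: "0 < t * ?p" using t tphi(3)[OF t] by simp
      have "expectation (\<lambda>\<omega>. vol m \<omega> powr - \<alpha>) \<le> 2 / real m"
        using pos m by (intro expectation_vol_powr) linarith
      also have "\<dots> \<le> 2 / (t * ?p)" using pos m by (intro divide_left_mono) auto
      also have "\<dots> = 2 * ?p powr \<alpha>"
        using tphi[OF t] by (simp add: powr_divide)
      finally show "expectation (\<lambda>\<omega>. vol m \<omega> powr - \<alpha>) \<le> 2 * ?p powr \<alpha>" .
    qed
    show "\<forall>\<^sub>F t in at_top. \<exists>n. 22 * (t * phi_alpha \<alpha> t) * (2 ^ Suc n) powr - \<alpha> \<le> 1 / 8 \<and>
      22 * (t * phi_alpha \<alpha> t) * (1 + trunc_mean n) \<le> C / phi_alpha \<alpha> t / 8"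
      using eventually_ge_at_top[of 1]
    proof eventually_elim
      case (elim t)
      define v where "v = 1 / phi_alpha \<alpha> t"
      have v: "1 \<le> v" and tp: "t * phi_alpha \<alpha> t = v powr \<alpha>" using tphi[OF elim] by (auto simp: v_def)
      have "1 * 1 \<le> A * v" using A v by (intro mult_mono) auto
      then obtain n where n: "2 ^ n \<le> A * v" "A * v < 2 ^ Suc n" using dyadic_scale[of "A * v"] by auto
      have "22 * v powr \<alpha> * (2 ^ Suc n) powr - \<alpha> \<le> 22 * v powr \<alpha> * (A * v) powr - \<alpha>"
        using n A v \<alpha>_pos by (intro mult_left_mono powr_mono2') auto
      also have "\<dots> = 22 * A powr - \<alpha>"
        using A v by (simp add: powr_mult powr_minus field_simps)
      also have "\<dots> = 1 / 8"
        unfolding A_def using \<alpha>_pos by (simp add: powr_powr powr_minus_divide)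
      finally have 1: "22 * v powr \<alpha> * (2 ^ Suc n) powr - \<alpha> \<le> 1 / 8" .
      have "1 + trunc_mean n \<le> K * (A * v) powr (1 - \<alpha>)"
        using n(1) assms K by (intro order_trans[OF trunc] mult_left_mono powr_mono2) auto
      then have "22 * v powr \<alpha> * (1 + trunc_mean n) \<le> 22 * v powr \<alpha> * (K * (A * v) powr (1 - \<alpha>))"
        by (intro mult_left_mono) auto
      also have "\<dots> = 22 * K * A powr (1 - \<alpha>) * (v powr \<alpha> * v powr (1 - \<alpha>))"
        using A v by (simp add: powr_mult mult_ac)
      also have "v powr \<alpha> * v powr (1 - \<alpha>) = v"
        using v by (simp add: powr_add[symmetric])
      finally have 2: "22 * v powr \<alpha> * (1 + trunc_mean n) \<le> C * v / 8"
        by (simp add: C_def mult_ac)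
      show ?case unfolding tp using 1 2 by (intro exI[of _ n]) (simp add: v_def)
    qed
  qed (use \<alpha>_pos C in auto)
qed

text \<open>The volume is linear in the radius: the bound from below is deterministic, depths being
  at least 1, and the truncated means are bounded by \<open>K\<close>. The limit \<open>lim\<close>
  says that a trap deeper than the radius is unlikely.\<close>

lemma moment_comparable_gt_1:
  assumes "1 < \<alpha>" shows "moment_comparable 1"
proof -
  define q where "q = 2 powr (1 - \<alpha>)"
  define K where "K = 1 + 1 / (1 - q)"
  have q: "0 < q" "q < 1"
    unfolding q_def using assms powr_less_mono[of "1 - \<alpha>" 0 2] by auto
  then have K: "0 < K" by (simp add: K_def add_pos_pos)
  have trunc: "1 + trunc_mean n \<le> K" for n
  proof -
    have "trunc_mean n = (1 - q ^ Suc n) / (1 - q)"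
      unfolding trunc_mean_def q_def[symmetric] using q sum_gp_strict[of q "Suc n"] by (simp only: lessThan_Suc_atMost) auto
    also have "\<dots> \<le> 1 / (1 - q)" using q by (intro divide_right_mono) auto
    finally show ?thesis by (simp add: K_def)
  qed
  have phi: "phi_alpha \<alpha> t = 1 / sqrt t" if "0 < t" for t
    using assms that by (simp add: phi_alpha_def powr_minus_divide powr_half_sqrt)
  have tphi: "t * phi_alpha \<alpha> t = sqrt t" if "0 < t" for t
    using that by (simp add: phi real_div_sqrt)
  have lim: "((\<lambda>t::real. 22 * (sqrt t * sqrt t powr - \<alpha>)) \<longlongrightarrow> 0) at_top"
  proof -
    have "((\<lambda>s::real. 22 * s powr (1 - \<alpha>)) \<longlongrightarrow> 22 * 0) at_top"
      using assms by (intro tendsto_mult tendsto_const tendsto_neg_powr filterlim_ident) auto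
    then have "((\<lambda>t. 22 * sqrt t powr (1 - \<alpha>)) \<longlongrightarrow> 0) at_top"
      using filterlim_compose[OF _ sqrt_at_top] by simp
    then show ?thesis
    proof (rule Lim_transform_eventually)
      show "\<forall>\<^sub>F t in at_top. 22 * sqrt t powr (1 - \<alpha>) = 22 * (sqrt t * sqrt t powr - \<alpha>)"
        using eventually_gt_at_top[of 0]
      proof eventually_elim
        case (elim t)
        then show ?case using powr_add[of "sqrt t" 1 "- \<alpha>"] by simp
      qed
    qed
  qed
  show ?thesis
  proof (rule moment_comparableI[where C\<^sub>1 = 1 and C\<^sub>2 = "176 * K"])
    show "\<forall>\<^sub>F t in at_top. 0 < phi_alpha \<alpha> t \<and> 1 \<le> t * phi_alpha \<alpha> t"
      using eventually_ge_at_top[of 1]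
      by eventually_elim (auto simp only: tphi, auto simp: phi)
    show "\<forall>\<^sub>F t in at_top. \<forall>m. t * phi_alpha \<alpha> t \<le> real m \<longrightarrow> real m \<le> 2 * (t * phi_alpha \<alpha> t) \<longrightarrow>
      expectation (\<lambda>\<omega>. vol m \<omega> powr - 1) \<le> 1 * phi_alpha \<alpha> t powr 1"
      using eventually_ge_at_top[of 1]
    proof (eventually_elim, intro allI impI)
      fix t :: real and m assume t: "1 \<le> t" and m: "t * phi_alpha \<alpha> t \<le> real m"
      have sm: "sqrt t \<le> real m" "0 < sqrt t" using t m by (auto simp: tphi)
      have "vol m \<omega> powr - 1 \<le> 1 / sqrt t" for \<omega>
      proof -
        have "sqrt t \<le> vol m \<omega>" using traps.volume_ge[of m \<omega>] sm by linarith
        then have "1 / vol m \<omega> \<le> 1 / sqrt t" using sm traps.volume_pos[of \<omega> m] by (intro divide_left_mono mult_pos_pos) auto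
        then show ?thesis using traps.volume_pos[of \<omega> m] by (simp add: powr_minus_divide)
      qed
      then have "expectation (\<lambda>\<omega>. vol m \<omega> powr - 1) \<le> expectation (\<lambda>\<omega>. 1 / sqrt t)"
        by (intro integral_mono integrable_vol_powr) auto
      then show "expectation (\<lambda>\<omega>. vol m \<omega> powr - 1) \<le> 1 * phi_alpha \<alpha> t powr 1"
        using t by (simp add: prob_space phi)
    qed
    show "\<forall>\<^sub>F t in at_top. \<exists>n. 22 * (t * phi_alpha \<alpha> t) * (2 ^ Suc n) powr - \<alpha> \<le> 1 / 8 \<and>
      22 * (t * phi_alpha \<alpha> t) * (1 + trunc_mean n) \<le> 176 * K / phi_alpha \<alpha> t / 8"
      using eventually_ge_at_top[of 1] order_tendstoD(2)[OF lim, of "1 / 8", simplified]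
    proof eventually_elim
      case (elim t)
      then have s: "1 \<le> sqrt t" by simp
      then obtain n where n: "2 ^ n \<le> sqrt t" "sqrt t < 2 ^ Suc n" using dyadic_scale by blast
      have "22 * sqrt t * (2 ^ Suc n) powr - \<alpha> \<le> 22 * sqrt t * sqrt t powr - \<alpha>"
        using n s assms by (intro mult_left_mono powr_mono2') auto
      also have "\<dots> \<le> 1 / 8" using elim by simp
      finally have 1: "22 * sqrt t * (2 ^ Suc n) powr - \<alpha> \<le> 1 / 8" .
      have 2: "22 * sqrt t * (1 + trunc_mean n) \<le> 22 * sqrt t * K"
        using trunc s by (intro mult_left_mono) auto
      have "t * phi_alpha \<alpha> t = sqrt t" using elim by (intro tphi) simp
      moreover have "176 * K / phi_alpha \<alpha> t / 8 = 22 * sqrt t * K"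
        using elim by (simp add: phi)
      ultimately show ?case using 1 2 by (intro exI[of _ n]) (simp only: simp_thms)
    qed
  qed (use K in auto)
qed

text \<open>The radius is \<open>y = sqrt (t / ln t)\<close> and the volume scale is
  \<open>v = y ln t\<close>. Truncating at \<open>v\<close> instead of \<open>y\<close> makes deep
  traps unlikely, as \<open>22 y / v = 22 / ln t\<close>, and keeps the truncated mean of order
  \<open>ln t\<close>.\<close>

lemma moment_comparable_eq_1:
  assumes "\<alpha> = 1" shows "moment_comparable 1"
proof -
  have phi: "phi_alpha \<alpha> t = 1 / (sqrt t * sqrt (ln t))" if "1 < t" for t
    using assms that by (simp add: phi_alpha_def powr_minus_divide powr_half_sqrt)
  have tphi: "t * phi_alpha \<alpha> t = sqrt t / sqrt (ln t)" if "1 < t" for t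
  proof -
    have "t * phi_alpha \<alpha> t = t / sqrt t / sqrt (ln t)" unfolding phi[OF that] by simp
    also have "t / sqrt t = sqrt t" using that by (intro real_div_sqrt) simp
    finally show ?thesis .
  qed
  have vy: "sqrt t * sqrt (ln t) = ln t * (sqrt t / sqrt (ln t))" if "1 < t" for t :: real
  proof -
    have "ln t * (sqrt t / sqrt (ln t)) = sqrt t * (ln t / sqrt (ln t))" by simp
    also have "ln t / sqrt (ln t) = sqrt (ln t)" using that by (intro real_div_sqrt) simp
    finally show ?thesis by simp
  qed
  have ev: "\<forall>\<^sub>F t::real in at_top. 1 < t \<and> 1 \<le> sqrt t / sqrt (ln t) \<and> ln t / 4 \<le> ln (sqrt t / sqrt (ln t))
      \<and> 1 \<le> sqrt t * sqrt (ln t) \<and> 176 \<le> ln t \<and> ln (sqrt t * sqrt (ln t)) \<le> ln t"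
    by (intro eventually_conj; real_asymp)
  show ?thesis
  proof (rule moment_comparableI[where C\<^sub>1 = 48 and C\<^sub>2 = 704])
    show "\<forall>\<^sub>F t in at_top. 0 < phi_alpha \<alpha> t \<and> 1 \<le> t * phi_alpha \<alpha> t"
      using ev
    proof eventually_elim
      case (elim t)
      then have "1 \<le> t * phi_alpha \<alpha> t" using tphi[of t] by simp
      then show ?case using phi[of t] elim by simp
    qed
    show "\<forall>\<^sub>F t in at_top. \<forall>m. t * phi_alpha \<alpha> t \<le> real m \<longrightarrow> real m \<le> 2 * (t * phi_alpha \<alpha> t) \<longrightarrow>
      expectation (\<lambda>\<omega>. vol m \<omega> powr - 1) \<le> 48 * phi_alpha \<alpha> t powr 1"
      using ev
    proof (eventually_elim, intro allI impI)
      fix t m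
      assume t: "1 < t \<and> 1 \<le> sqrt t / sqrt (ln t) \<and> ln t / 4 \<le> ln (sqrt t / sqrt (ln t))
          \<and> 1 \<le> sqrt t * sqrt (ln t) \<and> 176 \<le> ln t \<and> ln (sqrt t * sqrt (ln t)) \<le> ln t"
        and m: "t * phi_alpha \<alpha> t \<le> real m"
      let ?y = "sqrt t / sqrt (ln t)"
      have y: "1 \<le> ?y" "?y \<le> real m" using t m by (auto simp: tphi)
      then have "1 \<le> m" by linarith
      then obtain n where n: "2 ^ n \<le> m" "m < 2 ^ Suc n" using ex_power_ivl1[of 2 m] by auto
      have "ln t / 4 \<le> ln ?y" using t by simp
      also have "\<dots> \<le> ln (2 ^ Suc n)"
      proof -
        have "real m < real (2 ^ Suc n)" using n(2) by (simp only: of_nat_less_iff)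
        then have "?y \<le> 2 ^ Suc n" using y by simp
        then show ?thesis using y by (subst ln_le_cancel_iff) auto
      qed
      also have "\<dots> = real (n + 1) * ln 2" by (subst ln_realpow) auto
      also have "\<dots> \<le> real (n + 1) * 1" using ln_2_less_1 by (intro mult_left_mono) auto
      \<comment> \<open>The dyadic index of the radius is of order \<open>ln t\<close>; this
        supplies the logarithmic factor of \<open>phi_alpha\<close> and turns 12 into 48.\<close>
      finally have n1: "ln t / 4 \<le> real (n + 1)" by simp
      have "expectation (\<lambda>\<omega>. vol m \<omega> powr - 1) \<le> 12 / (real m * real (n + 1))"
        by (rule expectation_inverse_vol[OF assms n])
      also have "\<dots> \<le> 12 / (?y * (ln t / 4))"
        using y n1 t by (intro divide_left_mono mult_mono mult_pos_pos) auto
      also have "\<dots> = 48 * phi_alpha \<alpha> t"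
        using t by (simp only: phi vy) (simp add: mult.commute)
      finally show "expectation (\<lambda>\<omega>. vol m \<omega> powr - 1) \<le> 48 * phi_alpha \<alpha> t powr 1"
        using t by (simp add: phi)
    qed
    show "\<forall>\<^sub>F t in at_top. \<exists>n. 22 * (t * phi_alpha \<alpha> t) * (2 ^ Suc n) powr - \<alpha> \<le> 1 / 8 \<and>
      22 * (t * phi_alpha \<alpha> t) * (1 + trunc_mean n) \<le> 704 / phi_alpha \<alpha> t / 8"
      using ev
    proof eventually_elim
      case (elim t)
      let ?y = "sqrt t / sqrt (ln t)" and ?v = "sqrt t * sqrt (ln t)"
      have pos: "0 < ?y" using elim by auto
      have vy: "?v = ln t * ?y" using elim by (intro vy) simp
      obtain n where n: "2 ^ n \<le> ?v" "?v < 2 ^ Suc n" using dyadic_scale[of ?v] elim by blast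
      have "22 * ?y * (1 / 2 ^ Suc n) \<le> 22 * ?y * (1 / ?v)"
        using n pos elim by (intro mult_left_mono divide_left_mono) auto
      also have "\<dots> = 22 / ln t" unfolding vy using pos by simp
      also have "\<dots> \<le> 1 / 8" using elim by (simp add: field_simps)
      finally have 1: "22 * ?y * (1 / 2 ^ Suc n) \<le> 1 / 8" .
      have "real n * ln 2 = ln (2 ^ n)" by (subst ln_realpow) auto
      also have "\<dots> \<le> ln ?v" using n by (subst ln_le_cancel_iff) (auto intro: less_le_trans[of 0 "2 ^ n"])
      also have "\<dots> \<le> ln t" using elim by simp
      finally have "real n * ln 2 \<le> ln t" .
      moreover have "real n * (1 / 2) \<le> real n * ln 2"
        using ln_le_minus_one[of "1 / 2 :: real"] by (intro mult_left_mono) (auto simp: ln_div)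
      ultimately have "1 + trunc_mean n \<le> 4 * ln t"
        unfolding trunc_mean_def using assms elim by simp
      then have "22 * ?y * (1 + trunc_mean n) \<le> 22 * ?y * (4 * ln t)"
        using pos by (intro mult_left_mono) auto
      also have "\<dots> = 704 * ?v / 8" unfolding vy by simp
      finally have 2: "22 * ?y * (1 + trunc_mean n) \<le> 704 * ?v / 8" .
      have "(2 ^ Suc n) powr - \<alpha> = 1 / 2 ^ Suc n"
        using assms by (simp add: powr_minus_divide)
      moreover have "t * phi_alpha \<alpha> t = ?y" using elim by (intro tphi) simp
      moreover have "704 / phi_alpha \<alpha> t / 8 = 704 * ?v / 8" using elim by (simp add: phi)
      ultimately show ?case using 1 2 by (intro exI[of _ n]) (simp only: simp_thms)
    qed
  qed auto
qed

end

theorem mainTheorem5: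
  fixes M :: "'w measure" and \<tau> :: "'w \<Rightarrow> int \<Rightarrow> real" and \<alpha> :: real
  assumes "prob_space M"
    and "\<alpha> > 0"
    and indep: "prob_space.indep_vars M (\<lambda>_. borel) (\<lambda>x \<omega>. \<tau> \<omega> x) (UNIV :: int set)"
    and tail: "\<And>x u. u \<ge> 1 \<Longrightarrow> measure M {\<omega> \<in> space M. \<tau> \<omega> x > u} = u powr (- \<alpha>)"
  shows "(\<exists>\<epsilon>>0.
            0 < Liminf at_top (\<lambda>t. ereal (phi_alpha \<alpha> t powr (- \<epsilon>) *
                   (\<integral>\<omega>. bt_heat_kernel (\<tau> \<omega>) t 0 0 powr \<epsilon> \<partial>M))) \<and>
            Limsup at_top (\<lambda>t. ereal (phi_alpha \<alpha> t powr (- \<epsilon>) *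
                   (\<integral>\<omega>. bt_heat_kernel (\<tau> \<omega>) t 0 0 powr \<epsilon> \<partial>M))) < \<infinity>)
       \<and> (\<alpha> > 3 / 2 \<longrightarrow>
            0 < Liminf at_top (\<lambda>t. ereal (phi_alpha \<alpha> t powr (- 1) *
                   (\<integral>\<omega>. bt_heat_kernel (\<tau> \<omega>) t 0 0 powr 1 \<partial>M))) \<and>
            Limsup at_top (\<lambda>t. ereal (phi_alpha \<alpha> t powr (- 1) *
                   (\<integral>\<omega>. bt_heat_kernel (\<tau> \<omega>) t 0 0 powr 1 \<partial>M))) < \<infinity>)"
proof -
  interpret prob_space M by fact
  \<comment> \<open>Truncation from below at 1 preserves independence and the tail for
    \<open>u \<ge> 1\<close>, and yields an environment satisfying the locale at every
    outcome.\<close>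
  define T where "T = (\<lambda>\<omega> x. max 1 (\<tau> \<omega> x))"
  have meas [measurable]: "(\<lambda>\<omega>. \<tau> \<omega> x) \<in> borel_measurable M" for x
    using indep unfolding indep_vars_def by auto
  interpret pareto_traps M T \<alpha>
  proof
    show "indep_vars (\<lambda>_. borel) (\<lambda>x \<omega>. T \<omega> x) UNIV"
      unfolding T_def by (rule indep_vars_compose2[OF indep]) auto
    show "prob {\<omega> \<in> space M. u < T \<omega> x} = u powr - \<alpha>" if "1 \<le> u" for u x
    proof -
      have "{\<omega> \<in> space M. u < T \<omega> x} = {\<omega> \<in> space M. \<tau> \<omega> x > u}"
        using that by (auto simp: T_def)
      then show ?thesis using assms(4)[OF that] by simp
    qed
  qed (auto simp: T_def \<open>\<alpha> > 0\<close>)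
  \<comment> \<open>The tail at \<open>u = 1\<close> has probability one, and there are countably
    many sites, so both environments agree outside a single null set.\<close>
  have "AE \<omega> in M. 1 < \<tau> \<omega> x" for x
    using prob_Collect_eq_1[of "\<lambda>\<omega>. 1 < \<tau> \<omega> x"] assms(4)[of 1 x] by simp
  then have "AE \<omega> in M. \<forall>x. 1 < \<tau> \<omega> x" by (simp add: AE_all_countable)
  then have "AE \<omega> in M. \<tau> \<omega> = T \<omega>"
  proof eventually_elim
    case (elim \<omega>)
    show ?case
    proof
      fix x show "\<tau> \<omega> x = T \<omega> x" using elim[rule_format, of x] by (simp add: T_def)
    qed
  qed
  then have eq: "(\<integral>\<omega>. bt_heat_kernel (\<tau> \<omega>) t 0 0 powr \<epsilon> \<partial>M) = (\<integral>\<omega>. bt_heat_kernel (T \<omega>) t 0 0 powr \<epsilon> \<partial>M)" for t \<epsilon>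
    using measurable_bt_heat_kernel[of \<tau> M t 0 0] by (intro integral_cong_AE) (auto elim!: eventually_mono)
  consider "\<alpha> < 1" | "\<alpha> = 1" | "1 < \<alpha>" by linarith
  then have comp: "moment_comparable (if \<alpha> < 1 then \<alpha> else 1)"
  proof cases
    case 1
    then show ?thesis using moment_comparable_lt_1 by simp
  next
    case 2
    then have "\<not> \<alpha> < 1" by simp
    then show ?thesis using moment_comparable_eq_1[OF 2] by (simp only: if_False)
  next
    case 3
    then show ?thesis using moment_comparable_gt_1 by simp
  qed
  show ?thesis
    unfolding eq
  proof (intro conjI impI)
    show "\<exists>\<epsilon>>0. 0 < Liminf at_top (\<lambda>t. ereal (phi_alpha \<alpha> t powr (- \<epsilon>) *
                   (\<integral>\<omega>. bt_heat_kernel (T \<omega>) t 0 0 powr \<epsilon> \<partial>M))) \<and>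
            Limsup at_top (\<lambda>t. ereal (phi_alpha \<alpha> t powr (- \<epsilon>) *
                   (\<integral>\<omega>. bt_heat_kernel (T \<omega>) t 0 0 powr \<epsilon> \<partial>M))) < \<infinity>"
      using comp \<open>\<alpha> > 0\<close> unfolding moment_comparable_def by (intro exI[of _ "if \<alpha> < 1 then \<alpha> else 1"]) auto
  \<comment> \<open>For \<alpha> > 3/2 the regime \<alpha> > 1 already gives exponent one.\<close>
  qed (use moment_comparable_gt_1 in \<open>simp_all add: moment_comparable_def\<close>)
qed

end
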